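(* Let $G$ be a finitely generated group and suppose that $G$ admits a discontinuous, co-compact, isometric action on a length space $X$. Let $\mathcal H$ denote a collection of subgroups of $G$ consisting of exactly one representative of each conjugacy class of maximal isotropy subgroups for the action of $G$ on $X$. Then $\mathcal H$ is finite and, for any finite generating set $S$ of $G$, the coned-off Cayley graph $\Gamma_{S,\mathcal H}(G)$ is quasi-isometric to $X$. In particular, if $X$ is a Gromov hyperbolic space then the group $G$ is weakly hyperbolic relative to the collection $\mathcal H$ of maximal isotropy subgroups.
   Context: Let $G$ act by isometries on a metric space $X$. The action is co-compact if there is a compact set $K\subset X$ with $X=\bigcup_{g\in G}gK$. It is discontinuous if every orbit is a discrete subspace of $X$, equivalently for every $x\in X$ there exists $\epsilon_x>0$ such that $d(x,y)>\epsilon_x$ for all $y\in G(x)\setminus\{x\}$, where $G(x)$ is the orbit of $x$. A subgroup $H<G$ is an isotropy subgroup if its fixed set in $X$ is non-empty; maximal isotropy subgroups are those maximal with respect to inclusion among isotropy subgroups. A length space is a metric space in which the distance between two points is the infimum of the lengths of paths joining them. Let $S$ be a finite generating set of $G$ and $\mathcal H$ a finite family of subgroups of $G$. The coned-off Cayley graph $\Gamma_{S,\mathcal H}=\Gamma_{S,\mathcal H}(G)$ is obtained from the Cayley graph $\Gamma_S$ (edges of length $1$) by adding a vertex $V_{gH}$ for each left coset $gH$, $g\in G$, $H\in\mathcal H$, and joining $V_{gH}$ by an edge of length $\tfrac12$ to each vertex of $\Gamma_S$ labelled by an element of $gH$. $G$ is weakly hyperbolic relative to $\mathcal H$ if $\Gamma_{S,\mathcal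 H}$ is a Gromov hyperbolic space (this is independent of the choice of the finite generating set $S$).
   Formalization: The quasi-isometry and weak hyperbolicity claims assume in addition that every isotropy subgroup lies in a maximal isotropy subgroup; without this they fail, e.g. for BS(1,2) acting on its Bass–Serre tree. Finiteness of the collection needs no extra assumption. *)

theory Defs
  imports "HOL-Analysis.Analysis" "HOL-Algebra.Algebra"
begin

section \<open>Metric notions\<close>

text \<open>
  Metric spaces occur both as types of class \<^class>\<open>metric_space\<close> (the space acted upon) and as
  a carrier set with a distance function (metric graphs). The coarse notions below take the
  carrier and the distance as arguments, so a type is passed as \<^term>\<open>UNIV\<close> and \<^term>\<open>dist\<close>.
\<close>

text \<open>Supremum of polygonal lengths over the subdivisions
  \<open>0 \<le> t 0 \<le> \<dots> \<le> t n \<le> 1\<close>; non-rectifiable paths have length \<open>\<infinity>\<close>.\<close>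

definition path_length :: "(real \<Rightarrow> 'x::metric_space) \<Rightarrow> ennreal" where
  "path_length \<gamma> =
     (SUP (n, t) \<in> {(n :: nat, t :: nat \<Rightarrow> real). mono_on {..n} t \<and> t ` {..n} \<subseteq> {0..1}}.
        \<Sum>i<n. ennreal (dist (\<gamma> (t i)) (\<gamma> (t (Suc i)))))"

text \<open>The infimum of the empty set is \<open>\<infinity>\<close> in \<^typ>\<open>ennreal\<close>, so a length space
  is in particular connected by rectifiable paths.\<close>

definition length_space :: "'x::metric_space itself \<Rightarrow> bool" where
  "length_space _ \<longleftrightarrow>
     (\<forall>x y :: 'x. ennreal (dist x y) =
        (INF \<gamma> \<in> {\<gamma>. path \<gamma> \<and> pathstart \<gamma> = x \<and> pathfinish \<gamma> = y}. path_length \<gamma>))"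

definition quasi_isometric ::
    "'a set \<Rightarrow> ('a \<Rightarrow> 'a \<Rightarrow> real) \<Rightarrow> 'b set \<Rightarrow> ('b \<Rightarrow> 'b \<Rightarrow> real) \<Rightarrow> bool" where
  "quasi_isometric M d N d' \<longleftrightarrow>
     (\<exists>f \<in> M \<rightarrow> N. \<exists>k\<ge>1. \<exists>c\<ge>0.
        (\<forall>x\<in>M. \<forall>y\<in>M. d x y / k - c \<le> d' (f x) (f y) \<and> d' (f x) (f y) \<le> k * d x y + c) \<and>
        (\<forall>z\<in>N. \<exists>x\<in>M. d' z (f x) \<le> c))"

definition gromov_product :: "('a \<Rightarrow> 'a \<Rightarrow> real) \<Rightarrow> 'a \<Rightarrow> 'a \<Rightarrow> 'a \<Rightarrow> real" where
  "gromov_product d w x y = (d w x + d w y - d x y) / 2"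

text \<open>Gromov's definition, which unlike the one by thin triangles does not need geodesics
  and hence makes sense in an arbitrary length space.\<close>

definition gromov_hyperbolic :: "'a set \<Rightarrow> ('a \<Rightarrow> 'a \<Rightarrow> real) \<Rightarrow> bool" where
  "gromov_hyperbolic M d \<longleftrightarrow>
     (\<exists>\<delta>\<ge>0. \<forall>w\<in>M. \<forall>x\<in>M. \<forall>y\<in>M. \<forall>z\<in>M.
        min (gromov_product d w x z) (gromov_product d w z y) - \<delta> \<le> gromov_product d w x y)"

section \<open>Metric graphs\<close>

text \<open>The fields \<open>src\<close> and \<open>tgt\<close> parametrise an edge; walks may cross it either way.
  Loops and multiple edges are allowed.\<close>

record ('v, 'e) metric_graph =
  verts :: "'v set"
  edges :: "'e set"
  src :: "'e \<Rightarrow> 'v"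
  tgt :: "'e \<Rightarrow> 'v"
  len :: "'e \<Rightarrow> real"

text \<open>\<open>walk \<Gamma> u L v\<close>: there is an edge path of total length \<open>L\<close> from \<open>u\<close> to \<open>v\<close>.\<close>

inductive walk :: "('v, 'e) metric_graph \<Rightarrow> 'v \<Rightarrow> real \<Rightarrow> 'v \<Rightarrow> bool" for \<Gamma> where
  walk_nil: "v \<in> verts \<Gamma> \<Longrightarrow> walk \<Gamma> v 0 v"
| walk_fwd: "e \<in> edges \<Gamma> \<Longrightarrow> walk \<Gamma> (tgt \<Gamma> e) L v \<Longrightarrow> walk \<Gamma> (src \<Gamma> e) (len \<Gamma> e + L) v"
| walk_bwd: "e \<in> edges \<Gamma> \<Longrightarrow> walk \<Gamma> (src \<Gamma> e) L v \<Longrightarrow> walk \<Gamma> (tgt \<Gamma> e) (len \<Gamma> e + L) v"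

text \<open>Points of the geometric realisation: vertices, and for each edge \<open>e\<close> the interior points
  \<open>Inner e t\<close> at distance \<open>t\<close> along \<open>e\<close> from \<open>src e\<close>.\<close>

datatype ('v, 'e) gpoint = Vertex 'v | Inner 'e real

definition realisation :: "('v, 'e) metric_graph \<Rightarrow> ('v, 'e) gpoint set" where
  "realisation \<Gamma> =
     Vertex ` verts \<Gamma> \<union> {Inner e t | e t. e \<in> edges \<Gamma> \<and> 0 < t \<and> t < len \<Gamma> e}"

text \<open>The vertices where a path leaving a point can first meet the vertex set,
  with the distance travelled so far.\<close>

fun exits :: "('v, 'e) metric_graph \<Rightarrow> ('v, 'e) gpoint \<Rightarrow> ('v \<times> real) set" where
  "exits \<Gamma> (Vertex v) = {(v, 0)}"
| "exits \<Gamma> (Inner e t) = {(src \<Gamma> e, t), (tgt \<Gamma> e, len \<Gamma> e - t)}"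

text \<open>Lengths of paths in the realisation: either a path stays inside one open edge,
  or it goes to a vertex, follows an edge path and then goes to its end point.\<close>

inductive route :: "('v, 'e) metric_graph \<Rightarrow> ('v, 'e) gpoint \<Rightarrow> real \<Rightarrow> ('v, 'e) gpoint \<Rightarrow> bool"
  for \<Gamma> where
  within_edge: "route \<Gamma> (Inner e s) \<bar>s - t\<bar> (Inner e t)"
| via_vertices: "(u, a) \<in> exits \<Gamma> p \<Longrightarrow> (v, b) \<in> exits \<Gamma> q \<Longrightarrow> walk \<Gamma> u L v \<Longrightarrow>
    route \<Gamma> p (a + L + b) q"

text \<open>The path metric. It is only meaningful for connected graphs, where the infimum is taken
  over a non-empty set.\<close>

definition gdist :: "('v, 'e) metric_graph \<Rightarrow> ('v, 'e) gpoint \<Rightarrow> ('v, 'e) gpoint \<Rightarrow> real" where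
  "gdist \<Gamma> p q = Inf {r. route \<Gamma> p r q}"

section \<open>Coned-off Cayley graphs\<close>

definition finite_generating_set :: "('g, 'm) monoid_scheme \<Rightarrow> 'g set \<Rightarrow> bool" where
  "finite_generating_set G S \<longleftrightarrow> finite S \<and> S \<subseteq> carrier G \<and> generate G S = carrier G"

definition finitely_generated :: "('g, 'm) monoid_scheme \<Rightarrow> bool" where
  "finitely_generated G \<longleftrightarrow> (\<exists>S. finite_generating_set G S)"

text \<open>A left coset determines the subgroup it is a coset of, so the cone
  vertices can be labelled by the cosets alone.\<close>

definition left_cosets :: "('g, 'm) monoid_scheme \<Rightarrow> 'g set set \<Rightarrow> 'g set set" where
  "left_cosets G \<H> = (\<Union>H\<in>\<H>. lcosets\<^bsub>G\<^esub> H)"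

datatype 'g cone_vertex = Elem 'g | Cone "'g set"

text \<open>\<open>Cayley_edge g s\<close> joins \<open>g\<close> to \<open>g \<otimes> s\<close>; \<open>Cone_edge C g\<close> joins the cone vertex of the
  coset \<open>C\<close> to \<open>g \<in> C\<close>.\<close>

datatype 'g cone_edge = Cayley_edge 'g 'g | Cone_edge "'g set" 'g

definition coned_off_cayley_graph ::
    "('g, 'm) monoid_scheme \<Rightarrow> 'g set \<Rightarrow> 'g set set \<Rightarrow> ('g cone_vertex, 'g cone_edge) metric_graph"
  where
  "coned_off_cayley_graph G S \<H> =
     \<lparr> verts = Elem ` carrier G \<union> Cone ` left_cosets G \<H>,
       edges = {Cayley_edge g s | g s. g \<in> carrier G \<and> s \<in> S} \<union>
               {Cone_edge C g | C g. C \<in> left_cosets G \<H> \<and> g \<in> C},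
       src = (\<lambda>e. case e of Cayley_edge g s \<Rightarrow> Elem g | Cone_edge C g \<Rightarrow> Cone C),
       tgt = (\<lambda>e. case e of Cayley_edge g s \<Rightarrow> Elem (g \<otimes>\<^bsub>G\<^esub> s) | Cone_edge C g \<Rightarrow> Elem g),
       len = (\<lambda>e. case e of Cayley_edge g s \<Rightarrow> 1 | Cone_edge C g \<Rightarrow> 1 / 2) \<rparr>"

text \<open>Hyperbolicity of the coned-off graph does not depend on the finite generating set;
  the definition asks for it for all of them (and that there is one).\<close>

definition weakly_hyperbolic_relative_to :: "('g, 'm) monoid_scheme \<Rightarrow> 'g set set \<Rightarrow> bool" where
  "weakly_hyperbolic_relative_to G \<H> \<longleftrightarrow>
     finitely_generated G \<and> finite \<H> \<and> (\<forall>H\<in>\<H>. subgroup H G) \<and>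
     (\<forall>S. finite_generating_set G S \<longrightarrow>
        gromov_hyperbolic (realisation (coned_off_cayley_graph G S \<H>))
          (gdist (coned_off_cayley_graph G S \<H>)))"

section \<open>Isometric actions\<close>

definition isometric_action ::
    "('g, 'm) monoid_scheme \<Rightarrow> ('g \<Rightarrow> 'x::metric_space \<Rightarrow> 'x) \<Rightarrow> bool" where
  "isometric_action G \<phi> \<longleftrightarrow>
     group_action G UNIV \<phi> \<and> (\<forall>g\<in>carrier G. \<forall>x y. dist (\<phi> g x) (\<phi> g y) = dist x y)"

definition cocompact_action ::
    "('g, 'm) monoid_scheme \<Rightarrow> ('g \<Rightarrow> 'x::metric_space \<Rightarrow> 'x) \<Rightarrow> bool" where
  "cocompact_action G \<phi> \<longleftrightarrow> (\<exists>K. compact K \<and> (\<Union>g\<in>carrier G. \<phi> g ` K) = UNIV)"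

definition discontinuous_action ::
    "('g, 'm) monoid_scheme \<Rightarrow> ('g \<Rightarrow> 'x::metric_space \<Rightarrow> 'x) \<Rightarrow> bool" where
  "discontinuous_action G \<phi> \<longleftrightarrow> (\<forall>x. discrete (orbit G \<phi> x))"

definition isotropy_subgroup ::
    "('g, 'm) monoid_scheme \<Rightarrow> ('g \<Rightarrow> 'x \<Rightarrow> 'x) \<Rightarrow> 'g set \<Rightarrow> bool" where
  "isotropy_subgroup G \<phi> H \<longleftrightarrow> subgroup H G \<and> (\<exists>x. \<forall>h\<in>H. \<phi> h x = x)"

definition maximal_isotropy_subgroup ::
    "('g, 'm) monoid_scheme \<Rightarrow> ('g \<Rightarrow> 'x \<Rightarrow> 'x) \<Rightarrow> 'g set \<Rightarrow> bool" where
  "maximal_isotropy_subgroup G \<phi> H \<longleftrightarrow>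
     isotropy_subgroup G \<phi> H \<and> (\<forall>K. isotropy_subgroup G \<phi> K \<and> H \<subseteq> K \<longrightarrow> K = H)"

definition conjugate_subgroups :: "('g, 'm) monoid_scheme \<Rightarrow> 'g set \<Rightarrow> 'g set \<Rightarrow> bool" where
  "conjugate_subgroups G H K \<longleftrightarrow>
     (\<exists>g\<in>carrier G. K = (g <#\<^bsub>G\<^esub> H) #>\<^bsub>G\<^esub> (inv\<^bsub>G\<^esub> g))"

definition maximal_isotropy_representatives ::
    "('g, 'm) monoid_scheme \<Rightarrow> ('g \<Rightarrow> 'x \<Rightarrow> 'x) \<Rightarrow> 'g set set \<Rightarrow> bool" where
  "maximal_isotropy_representatives G \<phi> \<H> \<longleftrightarrow>
     (\<forall>H\<in>\<H>. maximal_isotropy_subgroup G \<phi> H) \<and>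
     (\<forall>M. maximal_isotropy_subgroup G \<phi> M \<longrightarrow> (\<exists>!H. H \<in> \<H> \<and> conjugate_subgroups G H M))"

text \<open>
  Discontinuity and co-compactness do not imply the next property: \<open>BS(1,2)\<close> acting on its
  Bass--Serre tree has properly ascending chains of vertex stabilisers and no maximal isotropy
  subgroup at all, and its Cayley graph is not quasi-isometric to the tree.
\<close>

definition isotropy_subgroups_below_maximal ::
    "('g, 'm) monoid_scheme \<Rightarrow> ('g \<Rightarrow> 'x \<Rightarrow> 'x) \<Rightarrow> bool" where
  "isotropy_subgroups_below_maximal G \<phi> \<longleftrightarrow>
     (\<forall>H. isotropy_subgroup G \<phi> H \<longrightarrow> (\<exists>M. maximal_isotropy_subgroup G \<phi> M \<and> H \<subseteq> M))"

end

theory Submission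
  imports Defs
begin

text \<open>The coned-off Cayley graph is compared with \<open>X\<close> through the word metric \<open>\<rho>\<close> on \<open>G\<close> for the
  generating set \<open>S \<union> S\<inverse> \<union> \<Union>\<H>\<close>: crossing a cone costs \<open>1/2 + 1/2\<close>, so up to an additive constant
  the graph is the group with the metric \<open>\<rho>\<close> (\<open>gdist_near_cone_dist\<close>). It remains to see that the
  orbit map \<open>g \<mapsto> g x\<^sub>0\<close> is a quasi-isometry from \<open>(G, \<rho>)\<close> to \<open>X\<close>.

  It is Lipschitz because every generator moves \<open>x\<^sub>0\<close> by a bounded amount; an element of \<open>H \<in> \<H>\<close>
  fixes a point, hence moves \<open>x\<^sub>0\<close> by at most twice the distance to that point. The converse bound is a
  version of the Milnor--Schwarz argument that works although stabilisers may be infinite and balls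
  need not be compact. Discontinuity gives each point \<open>p\<close> a radius \<open>r p\<close> so small that no ball of radius
  \<open>3 r p\<close> contains two points of the orbit of \<open>p\<close>, and co-compactness gives a finite set \<open>P\<close> such
  that the translates \<open>g B(p, r p)\<close> with \<open>p \<in> P\<close> cover \<open>X\<close>. Now let two such balls, around \<open>g p\<close> and
  \<open>h q\<close>, be close to each other, and let \<open>r q\<close> be the larger radius. Then \<open>h q\<close> is the \<^emph>\<open>only\<close>
  translate of \<open>q\<close> near \<open>g p\<close>, so \<open>h\<close> is determined up to right multiplication by the stabiliser of
  \<open>q\<close>. Stabilisers lie, by hypothesis, in maximal isotropy subgroups, hence in conjugates of members of \<open>\<H>\<close>, and
  so have bounded \<open>\<rho>\<close>-diameter. Consequently \<open>\<rho> g h\<close> is bounded for neighbouring balls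
  (\<open>cone_dist_bounded_if_balls_near\<close>), and following a nearly shortest path in the length space \<open>X\<close>
  bounds \<open>\<rho>\<close> linearly by the distance in \<open>X\<close>.

  The same balls show that \<open>\<H>\<close> is finite: the stabiliser of a point of \<open>g B(p, r p)\<close> fixes \<open>g p\<close>, so a
  maximal isotropy subgroup is conjugate to the stabiliser of one of the finitely many \<open>p \<in> P\<close>.

  For the last claim the four-point condition has to be transferred along the quasi-isometry. This
  is not a formal consequence of the definition; it rests on the stability of quasi-geodesics
  (\<open>quasi_geodesic_stability\<close>). Its proof needs Gromov products only: the product of the
  ends of a chain of \<open>2\<^sup>k\<close> steps is at least the smallest product of a step minus \<open>k \<delta>\<close>, so a detour
  that keeps away a distance \<open>D\<close> from a point near a geodesic has to be exponentially long
  in \<open>D\<close>, which a quasi-geodesic cannot afford. It follows that triangles in \<open>(G, \<rho>)\<close>, whose sides are discrete geodesics, are thin, and thin triangles give back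
  the four-point condition.\<close>

section \<open>Gromov products and nearly shortest paths\<close>

lemma gromov_product_commute: "gromov_product dist w x y = gromov_product dist w y x"
  by (simp add: gromov_product_def dist_commute)

text \<open>Hyperbolicity of a whole type, with the constant made explicit.\<close>

definition four_point :: "'x::metric_space itself \<Rightarrow> real \<Rightarrow> bool" where
  "four_point _ \<delta> \<longleftrightarrow> (\<forall>w x y z :: 'x.
     min (gromov_product dist w x z) (gromov_product dist w z y) - \<delta> \<le> gromov_product dist w x y)"

lemma four_pointD:
  fixes w :: "'x::metric_space"
  assumes "four_point TYPE('x) \<delta>" "m \<le> gromov_product dist w x z" "m \<le> gromov_product dist w z y"
  shows "m - \<delta> \<le> gromov_product dist w x y"
proof -
  have "min (gromov_product dist w x z) (gromov_product dist w z y) - \<delta> \<le> gromov_product dist w x y"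
    using assms(1) unfolding four_point_def by blast
  with assms(2,3) show ?thesis by linarith
qed

lemma gromov_product_step: "dist w x - dist x y \<le> gromov_product dist w x y"
  unfolding gromov_product_def using dist_triangle[of w x y] by (simp add: dist_commute)

lemma gromov_product_perturb:
  "gromov_product dist w x y \<le> gromov_product dist w' x y + dist w w'"
  unfolding gromov_product_def using dist_triangle[of w x w'] dist_triangle[of w y w']
  by (simp add: field_simps)

text \<open>Halving the chain \<open>k\<close> times uses the four-point condition \<open>k\<close> times, so the loss is only
  logarithmic in the number of steps. This is the source of the exponential divergence in hyperbolic
  spaces.\<close>

lemma gromov_product_chain:
  fixes x :: "nat \<Rightarrow> 'x::metric_space"
  assumes hyp: "four_point TYPE('x) \<delta>" and "0 \<le> \<delta>"
    and "0 < n" "n \<le> 2 ^ k"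
    and "\<And>i. i < n \<Longrightarrow> m \<le> gromov_product dist w (x i) (x (Suc i))"
  shows "m - real k * \<delta> \<le> gromov_product dist w (x 0) (x n)"
  using assms(3-)
proof (induction k arbitrary: n x)
  case 0
  then have "n = 1" by simp
  then show ?case using "0.prems"(3)[of 0] by simp
next
  case (Suc k)
  show ?case
  proof (cases "n \<le> 2 ^ k")
    case True
    have "m - real k * \<delta> \<le> gromov_product dist w (x 0) (x n)"
      using Suc.IH[of n x] Suc.prems True by blast
    then show ?thesis using \<open>0 \<le> \<delta>\<close> by (simp add: algebra_simps)
  next
    case False
    define p where "p = (2::nat) ^ k"
    have p: "0 < p" "p < n" "n - p \<le> 2 ^ k" using False Suc.prems by (auto simp: p_def)
    have "m - real k * \<delta> \<le> gromov_product dist w (x 0) (x p)"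
      using Suc.IH[of p x] p Suc.prems by (simp add: p_def)
    moreover have "m - real k * \<delta> \<le> gromov_product dist w (x p) (x n)"
      using Suc.IH[of "n - p" "\<lambda>i. x (p + i)"] p Suc.prems by simp
    ultimately have "m - real k * \<delta> - \<delta> \<le> gromov_product dist w (x 0) (x n)"
      by (rule four_pointD[OF hyp])
    then show ?thesis by (simp add: algebra_simps)
  qed
qed

lemma path_length_three_points:
  fixes \<gamma> :: "real \<Rightarrow> 'x::metric_space"
  assumes "0 \<le> s" "s \<le> t" "t \<le> u" "u \<le> 1"
  shows "ennreal (dist (\<gamma> 0) (\<gamma> s) + dist (\<gamma> s) (\<gamma> t) + dist (\<gamma> t) (\<gamma> u) + dist (\<gamma> u) (\<gamma> 1))
    \<le> path_length \<gamma>"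
proof -
  define \<tau> :: "nat \<Rightarrow> real" where "\<tau> = (\<lambda>i. [0, s, t, u, 1] ! i)"
  have \<tau>: "\<tau> 0 = 0" "\<tau> 1 = s" "\<tau> 2 = t" "\<tau> 3 = u" "\<tau> 4 = 1" by (simp_all add: \<tau>_def)
  have c: "i \<in> {..4} \<longleftrightarrow> i = 0 \<or> i = 1 \<or> i = 2 \<or> i = 3 \<or> i = 4" for i :: nat by auto
  have "mono_on {..4} \<tau>"
  proof (rule mono_onI)
    fix i j :: nat assume "i \<in> {..4}" "j \<in> {..4}" "i \<le> j"
    then show "\<tau> i \<le> \<tau> j" unfolding c using assms \<tau> by auto
  qed
  moreover have "\<tau> ` {..4} \<subseteq> {0..1}"
  proof
    fix y assume "y \<in> \<tau> ` {..4}"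
    then obtain i where "i \<in> {..4}" "y = \<tau> i" by auto
    then show "y \<in> {0..1}" unfolding c using assms \<tau> by auto
  qed
  ultimately have "(\<Sum>i<4. ennreal (dist (\<gamma> (\<tau> i)) (\<gamma> (\<tau> (Suc i))))) \<le> path_length \<gamma>"
    unfolding path_length_def by (intro SUP_upper2[of "(4, \<tau>)"]) auto
  moreover have "(\<Sum>i<4. ennreal (dist (\<gamma> (\<tau> i)) (\<gamma> (\<tau> (Suc i))))) =
     ennreal (dist (\<gamma> 0) (\<gamma> s) + dist (\<gamma> s) (\<gamma> t) + dist (\<gamma> t) (\<gamma> u) + dist (\<gamma> u) (\<gamma> 1))"
    by (simp add: numeral_eq_Suc \<tau>_def ennreal_plus)
  ultimately show ?thesis by simp
qed

text \<open>Length spaces need not contain geodesics. A path whose length exceeds the distance of its ends by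
  less than \<open>\<epsilon>\<close> satisfies the reversed triangle inequality up to \<open>\<epsilon>\<close> for \<^emph>\<open>all\<close> its points in order,
  because the excess of any part is at most the excess of the whole.\<close>

lemma near_geodesic_exists:
  fixes x y :: "'x::metric_space"
  assumes "length_space TYPE('x)" "0 < \<epsilon>"
  obtains \<gamma> where "path \<gamma>" "\<gamma> 0 = x" "\<gamma> 1 = y"
    "\<And>s t u. 0 \<le> s \<Longrightarrow> s \<le> t \<Longrightarrow> t \<le> u \<Longrightarrow> u \<le> 1 \<Longrightarrow>
       dist (\<gamma> s) (\<gamma> t) + dist (\<gamma> t) (\<gamma> u) \<le> dist (\<gamma> s) (\<gamma> u) + \<epsilon>"
proof -
  have "(INF \<gamma> \<in> {\<gamma>. path \<gamma> \<and> pathstart \<gamma> = x \<and> pathfinish \<gamma> = y}. path_length \<gamma>)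
      < ennreal (dist x y + \<epsilon>)"
  proof -
    have "ennreal (dist x y) < ennreal (dist x y + \<epsilon>)"
      using assms(2) by (intro ennreal_lessI) (auto simp: add_nonneg_pos)
    then show ?thesis using assms(1) unfolding length_space_def by simp
  qed
  then obtain \<gamma> where \<gamma>: "path \<gamma>" "\<gamma> 0 = x" "\<gamma> 1 = y" "path_length \<gamma> < ennreal (dist x y + \<epsilon>)"
    unfolding INF_less_iff by (auto simp: pathstart_def pathfinish_def)
  show thesis
  proof (rule that[OF \<gamma>(1-3)])
    fix s t u :: real assume a: "0 \<le> s" "s \<le> t" "t \<le> u" "u \<le> 1"
    have "ennreal (dist (\<gamma> 0) (\<gamma> s) + dist (\<gamma> s) (\<gamma> t) + dist (\<gamma> t) (\<gamma> u) + dist (\<gamma> u) (\<gamma> 1))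
      < ennreal (dist x y + \<epsilon>)"
      using path_length_three_points[OF a, of \<gamma>] \<gamma>(4) by (rule le_less_trans)
    then have "dist (\<gamma> 0) (\<gamma> s) + dist (\<gamma> s) (\<gamma> t) + dist (\<gamma> t) (\<gamma> u) + dist (\<gamma> u) (\<gamma> 1)
      < dist x y + \<epsilon>"
      by (subst (asm) ennreal_less_iff) auto
    moreover have "dist x y \<le> dist (\<gamma> 0) (\<gamma> s) + dist (\<gamma> s) (\<gamma> u) + dist (\<gamma> u) (\<gamma> 1)"
      using \<gamma>(2,3) dist_triangle[of x y "\<gamma> s"] dist_triangle[of "\<gamma> s" y "\<gamma> u"] by simp
    ultimately show "dist (\<gamma> s) (\<gamma> t) + dist (\<gamma> t) (\<gamma> u) \<le> dist (\<gamma> s) (\<gamma> u) + \<epsilon>" by linarith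
  qed
qed

lemma path_dist_attained:
  fixes \<gamma> :: "real \<Rightarrow> 'x::metric_space"
  assumes "path \<gamma>" "a \<in> {0..1}" "b \<in> {0..1}" "0 \<le> r" "r \<le> dist (\<gamma> a) (\<gamma> b)"
  obtains s where "s \<in> closed_segment a b" "dist (\<gamma> a) (\<gamma> s) = r"
proof -
  have "closed_segment a b \<subseteq> {0..1}"
    using assms by (intro closed_segment_subset) auto
  then have "continuous_on (closed_segment a b) (\<lambda>s. dist (\<gamma> a) (\<gamma> s))"
    using assms(1) unfolding path_def by (intro continuous_intros) (auto elim: continuous_on_subset)
  then have "connected ((\<lambda>s. dist (\<gamma> a) (\<gamma> s)) ` closed_segment a b)"
    by (intro connected_continuous_image) auto
  then have "{dist (\<gamma> a) (\<gamma> a)..dist (\<gamma> a) (\<gamma> b)} \<subseteq> (\<lambda>s. dist (\<gamma> a) (\<gamma> s)) ` closed_segment a b"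
    by (rule connected_contains_Icc) auto
  then have "r \<in> (\<lambda>s. dist (\<gamma> a) (\<gamma> s)) ` closed_segment a b" using assms by auto
  then show ?thesis using that by auto
qed

text \<open>From \<open>ln u \<le> u - 1\<close> at \<open>u = \<eta> (a D + b)\<close>, with \<open>\<eta>\<close> so small that the resulting linear term
  is \<open>D / 2\<close>.\<close>

lemma log_bounded:
  assumes "0 \<le> \<delta>" "0 < a" "0 < b"
  obtains D0 :: real where "\<And>D. 0 \<le> D \<Longrightarrow> D \<le> \<delta> * log 2 (a * D + b) + e \<Longrightarrow> D \<le> D0"
proof (cases "\<delta> = 0")
  case True
  show ?thesis by (rule that[of e]) (simp add: True)
next
  case False
  define \<delta>' where "\<delta>' = \<delta> / ln 2"
  have \<delta>': "\<delta>' > 0" using False assms by (simp add: \<delta>'_def)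
  define \<eta> where "\<eta> = 1 / (2 * a * \<delta>')"
  have \<eta>: "\<eta> > 0" using assms \<delta>' by (simp add: \<eta>_def)
  show ?thesis
  proof (rule that)
    fix D :: real assume D: "0 \<le> D" "D \<le> \<delta> * log 2 (a * D + b) + e"
    have pos: "a * D + b > 0" using assms D by (simp add: add_nonneg_pos)
    have "ln (\<eta> * (a * D + b)) \<le> \<eta> * (a * D + b) - 1"
      using pos \<eta> by (intro ln_le_minus_one) simp
    moreover have "ln (\<eta> * (a * D + b)) = ln \<eta> + ln (a * D + b)"
      using pos \<eta> by (simp add: ln_mult)
    ultimately have "\<delta>' * ln (a * D + b) \<le> \<delta>' * (\<eta> * (a * D + b) - 1 - ln \<eta>)"
      using \<delta>' by (intro mult_left_mono) auto
    also have "\<dots> = D / 2 + \<delta>' * (\<eta> * b - 1 - ln \<eta>)"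
      using assms \<delta>' unfolding \<eta>_def by (simp add: field_simps)
    finally have "D \<le> D / 2 + \<delta>' * (\<eta> * b - 1 - ln \<eta>) + e"
      using D by (simp add: \<delta>'_def log_def)
    then show "D \<le> 2 * (\<delta>' * (\<eta> * b - 1 - ln \<eta>) + e)" by simp
  qed
qed

section \<open>Stability of quasi-geodesics\<close>

text \<open>A single constant serves as multiplicative and as additive error; it may be taken to be the larger one.\<close>

definition quasi_geodesic :: "real \<Rightarrow> (nat \<Rightarrow> 'x::metric_space) \<Rightarrow> nat \<Rightarrow> bool" where
  "quasi_geodesic K c n \<longleftrightarrow> (\<forall>i\<le>n. \<forall>j\<le>n.
     \<bar>real i - real j\<bar> / K - K \<le> dist (c i) (c j) \<and> dist (c i) (c j) \<le> K * \<bar>real i - real j\<bar> + K)"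

lemma quasi_geodesicD:
  assumes "quasi_geodesic K c n" "0 < K" "i \<le> n" "j \<le> n"
  shows "\<bar>real i - real j\<bar> \<le> K * (dist (c i) (c j) + K)"
    and "dist (c i) (c j) \<le> K * \<bar>real i - real j\<bar> + K"
proof -
  have "\<bar>real i - real j\<bar> / K \<le> dist (c i) (c j) + K"
    using assms unfolding quasi_geodesic_def by fastforce
  then show "\<bar>real i - real j\<bar> \<le> K * (dist (c i) (c j) + K)"
    using assms(2) by (simp add: field_simps)
qed (use assms in \<open>auto simp: quasi_geodesic_def\<close>)

text \<open>Each step of a quasi-geodesic with constant \<open>K\<close> has length at most \<open>2 K\<close>, so a part that keeps
  distance \<open>D\<close> from \<open>w\<close> is a chain to which \<open>gromov_product_chain\<close> applies.\<close>

lemma gromov_product_quasi_geodesic: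
  fixes c :: "nat \<Rightarrow> 'x::metric_space"
  assumes hyp: "four_point TYPE('x) \<delta>" "0 \<le> \<delta>" and qg: "quasi_geodesic K c n" "1 \<le> K"
    and "i \<le> n" "j \<le> n" and far: "\<And>l. l \<le> n \<Longrightarrow> D \<le> dist w (c l)"
    and k: "\<bar>real i - real j\<bar> \<le> 2 ^ k"
  shows "D - 2 * K - real k * \<delta> \<le> gromov_product dist w (c i) (c j)"
proof -
  have *: "D - 2 * K - real k * \<delta> \<le> gromov_product dist w (c i) (c j)"
    if ij: "i \<le> j" "j \<le> n" "\<bar>real i - real j\<bar> \<le> 2 ^ k" for i j
  proof (cases "i = j")
    case True
    have "D \<le> gromov_product dist w (c i) (c j)"
      using far[of i] ij True by (simp add: gromov_product_def)
    moreover have "0 \<le> real k * \<delta>" using hyp by simp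
    ultimately show ?thesis using qg(2) by linarith
  next
    case False
    have "real (j - i) \<le> 2 ^ k" using ij by (simp add: of_nat_diff)
    then have "j - i \<le> 2 ^ k" by (metis of_nat_le_iff of_nat_numeral of_nat_power)
    moreover have "D - 2 * K \<le> gromov_product dist w (c (i + l)) (c (i + Suc l))"
      if "l < j - i" for l
    proof -
      have "dist (c (i + l)) (c (i + Suc l)) \<le> K * \<bar>real (i + l) - real (i + Suc l)\<bar> + K"
        using that ij qg by (intro quasi_geodesicD(2)[OF qg(1)]) auto
      moreover have "\<bar>real (i + l) - real (i + Suc l)\<bar> = 1" by simp
      ultimately have "dist (c (i + l)) (c (i + Suc l)) \<le> 2 * K" by simp
      moreover have "D \<le> dist w (c (i + l))" using that ij by (intro far) auto
      ultimately show ?thesis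
        using gromov_product_step[of w "c (i + l)" "c (i + Suc l)"] by linarith
    qed
    ultimately show ?thesis
      using gromov_product_chain[OF hyp, of "j - i" k "D - 2 * K" w "\<lambda>l. c (i + l)"] ij False by simp
  qed
  show ?thesis
  proof (cases "i \<le> j")
    case True
    then show ?thesis using * assms by blast
  next
    case False
    then show ?thesis
      using *[of j i] assms by (simp add: gromov_product_commute[of w "c i"] abs_minus_commute)
  qed
qed

text \<open>The point \<open>\<gamma> s0\<close> is one that is farthest from the quasi-geodesic, at distance \<open>D\<close>. Leaving it along
  \<open>\<gamma>\<close> in either direction for a distance \<open>2 D\<close> (or until the end of \<open>\<gamma>\<close>, which lies on the
  quasi-geodesic) and then going over to the nearest \<open>c i\<close> is a detour that stays \<open>D\<close> away from
  \<open>\<gamma> s0\<close>; the bound \<open>3 D\<close> limits the length of the part of \<open>c\<close> between the two landing points.\<close>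

lemma detour_endpoint:
  fixes \<gamma> :: "real \<Rightarrow> 'x::metric_space"
  assumes "path \<gamma>" "s0 \<in> {0..1}" "e \<in> {0..1}" "0 \<le> D" "i0 \<le> n" "\<gamma> e = c i0"
    and far: "\<And>l. l \<le> n \<Longrightarrow> D \<le> dist (\<gamma> s0) (c l)"
    and near: "\<And>s. s \<in> {0..1} \<Longrightarrow> \<exists>i\<le>n. dist (\<gamma> s) (c i) \<le> D"
  obtains s i where "s \<in> closed_segment s0 e" "i \<le> n"
    "D \<le> gromov_product dist (\<gamma> s0) (\<gamma> s) (c i)" "dist (\<gamma> s0) (c i) \<le> 3 * D"
proof (cases "dist (\<gamma> s0) (\<gamma> e) \<le> 2 * D")
  case True
  have "D \<le> gromov_product dist (\<gamma> s0) (\<gamma> e) (c i0)" "dist (\<gamma> s0) (c i0) \<le> 3 * D"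
    using True assms(4-6) far[of i0] by (simp_all add: gromov_product_def)
  then show ?thesis by (intro that[OF ends_in_segment(2) assms(5)])
next
  case False
  then obtain s where s: "s \<in> closed_segment s0 e" "dist (\<gamma> s0) (\<gamma> s) = 2 * D"
    using path_dist_attained[OF assms(1-3), of "2 * D"] assms(4) by auto
  have "closed_segment s0 e \<subseteq> {0..1}"
    using assms by (intro closed_segment_subset) auto
  then obtain i where i: "i \<le> n" "dist (\<gamma> s) (c i) \<le> D" using near s by blast
  have "dist (\<gamma> s0) (c i) \<le> 3 * D" using dist_triangle[of "\<gamma> s0" "c i" "\<gamma> s"] i s by linarith
  moreover have "D \<le> gromov_product dist (\<gamma> s0) (\<gamma> s) (c i)"
    using far[OF i(1)] i s by (simp add: gromov_product_def)
  ultimately show ?thesis using that s i by blast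
qed

text \<open>Let \<open>D\<close> be the largest distance of a point \<open>w\<close> of \<open>\<gamma>\<close> from the quasi-geodesic. The detour around
  \<open>w\<close> described by \<open>detour_endpoint\<close> follows \<open>c\<close> for \<open>O(D)\<close> steps, hence its ends have Gromov product
  at least \<open>D - O(log D)\<close> at \<open>w\<close>. But they lie on \<open>\<gamma>\<close> on different sides of \<open>w\<close>, so this product is
  at most \<open>1/2\<close>, and \<open>D\<close> is bounded.\<close>

lemma near_geodesic_near_quasi_geodesic:
  assumes hyp: "four_point TYPE('x::metric_space) \<delta>" "0 \<le> \<delta>" and K: "1 \<le> K"
  obtains D0 where "\<And>(c :: nat \<Rightarrow> 'x) n \<gamma> s. quasi_geodesic K c n \<Longrightarrow> path \<gamma> \<Longrightarrow> \<gamma> 0 = c 0 \<Longrightarrow> \<gamma> 1 = c n \<Longrightarrow>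
     (\<And>s t u. 0 \<le> s \<Longrightarrow> s \<le> t \<Longrightarrow> t \<le> u \<Longrightarrow> u \<le> 1 \<Longrightarrow>
       dist (\<gamma> s) (\<gamma> t) + dist (\<gamma> t) (\<gamma> u) \<le> dist (\<gamma> s) (\<gamma> u) + 1) \<Longrightarrow>
     s \<in> {0..1} \<Longrightarrow> \<exists>i\<le>n. dist (\<gamma> s) (c i) \<le> D0"
proof -
  obtain D0 where D0: "\<And>D. 0 \<le> D \<Longrightarrow>
      D \<le> \<delta> * log 2 ((6 * K) * D + (K * K + 1)) + (2 * K + 3 * \<delta> + 1) \<Longrightarrow> D \<le> D0"
    using log_bounded[OF hyp(2), of "6 * K" "K * K + 1" "2 * K + 3 * \<delta> + 1"] K
    by (auto simp: add_nonneg_pos)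
  show thesis
  proof (rule that[of D0])
    fix c :: "nat \<Rightarrow> 'x" and n \<gamma> and s :: real
    assume qg: "quasi_geodesic K c n" and \<gamma>: "path \<gamma>" "\<gamma> 0 = c 0" "\<gamma> 1 = c n"
      and geo: "\<And>s t u. 0 \<le> s \<Longrightarrow> s \<le> t \<Longrightarrow> t \<le> u \<Longrightarrow> u \<le> 1 \<Longrightarrow>
       dist (\<gamma> s) (\<gamma> t) + dist (\<gamma> t) (\<gamma> u) \<le> dist (\<gamma> s) (\<gamma> u) + 1"
      and s: "s \<in> {0..1}"
    define h where "h = (\<lambda>s. infdist (\<gamma> s) (c ` {..n}))"
    have h_le: "h s \<le> dist (\<gamma> s) (c l)" if "l \<le> n" for s l
      unfolding h_def using that by (intro infdist_le) auto
    have h: "\<exists>i\<le>n. dist (\<gamma> s) (c i) = h s" for s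
    proof -
      define d where "d i = dist (\<gamma> s) (c i)" for i
      have "Min (d ` {..n}) \<in> d ` {..n}" by (intro Min_in) auto
      then obtain i where "i \<in> {..n}" "Min (d ` {..n}) = d i" by (rule imageE)
      then have i: "i \<le> n" "d i = Min (d ` {..n})" by auto
      have "d i \<le> h s"
        unfolding h_def using i(2)
        by (subst infdist_notempty) (auto simp: d_def[symmetric] intro!: cINF_greatest)
      then show ?thesis using i(1) h_le[OF i(1), of s] by (auto simp: d_def)
    qed
    have "continuous_on {0..1} h"
      unfolding h_def using \<gamma>(1) unfolding path_def by (intro continuous_intros)
    then obtain s0 where s0: "s0 \<in> {0..1}" "\<And>s. s \<in> {0..1} \<Longrightarrow> h s \<le> h s0"
      using continuous_attains_sup[of "{0..1::real}" h] by auto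
    define D where "D = h s0"
    have D_nn: "0 \<le> D" unfolding D_def h_def by (rule infdist_nonneg)
    have far: "D \<le> dist (\<gamma> s0) (c l)" if "l \<le> n" for l using h_le that by (simp add: D_def)
    have near: "\<exists>i\<le>n. dist (\<gamma> s) (c i) \<le> D" if "s \<in> {0..1}" for s
      using h[of s] s0(2)[OF that] by (auto simp: D_def)
    obtain s1 i where i: "s1 \<in> closed_segment s0 0" "i \<le> n"
      "D \<le> gromov_product dist (\<gamma> s0) (\<gamma> s1) (c i)" "dist (\<gamma> s0) (c i) \<le> 3 * D"
      using detour_endpoint[OF \<gamma>(1) s0(1), of 0 D 0 n c] D_nn \<gamma> far near
      by (metis atLeastAtMost_iff le0 order_refl zero_le_one)
    obtain s2 j where j: "s2 \<in> closed_segment s0 1" "j \<le> n"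
      "D \<le> gromov_product dist (\<gamma> s0) (\<gamma> s2) (c j)" "dist (\<gamma> s0) (c j) \<le> 3 * D"
      using detour_endpoint[OF \<gamma>(1) s0(1), of 1 D n n c] D_nn \<gamma> far near
      by (metis atLeastAtMost_iff order_refl zero_le_one)
    have ord: "0 \<le> s1" "s1 \<le> s0" "s0 \<le> s2" "s2 \<le> 1"
      using i(1) j(1) s0(1) by (auto simp: closed_segment_eq_real_ivl split: if_splits)
    have small: "gromov_product dist (\<gamma> s0) (\<gamma> s1) (\<gamma> s2) \<le> 1 / 2"
      using geo[OF ord] by (simp add: gromov_product_def dist_commute)
    have nn: "0 \<le> real k * \<delta>" for k using hyp by simp
    \<comment> \<open>a bound for the number of steps of \<open>c\<close> between the two landing points: these are at distance at most \<open>6 D\<close> from each other\<close>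
    define N where "N = 6 * K * D + (K * K + 1)"
    have N1: "1 \<le> N" using K D_nn by (simp add: N_def)
    define k where "k = nat \<lceil>log 2 N\<rceil>"
    have logN: "0 \<le> log 2 N" using N1 by simp
    have kN: "real k \<le> log 2 N + 1" using logN unfolding k_def by linarith
    have "log 2 N \<le> real k" unfolding k_def by linarith
    then have N2: "N \<le> 2 ^ k" using N1 by (simp add: log_le_iff powr_realpow)
    have "\<bar>real i - real j\<bar> \<le> K * (dist (c i) (c j) + K)"
      using quasi_geodesicD(1)[OF qg _ i(2) j(2)] K by simp
    also have "\<dots> \<le> K * (6 * D + K)"
      using K i(4) j(4) dist_triangle3[of "c i" "c j" "\<gamma> s0"] by (intro mult_left_mono) auto
    also have "\<dots> \<le> N" by (simp add: N_def algebra_simps)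
    finally have "D - 2 * K - real k * \<delta> \<le> gromov_product dist (\<gamma> s0) (c i) (c j)"
      using N2 by (intro gromov_product_quasi_geodesic[OF hyp qg K i(2) j(2) far]) auto
    moreover have "D - 2 * K - real k * \<delta> \<le> gromov_product dist (\<gamma> s0) (\<gamma> s1) (c i)"
      using i(3) K nn[of k] by linarith
    ultimately have "D - 2 * K - real k * \<delta> - \<delta> \<le> gromov_product dist (\<gamma> s0) (\<gamma> s1) (c j)"
      using four_pointD[OF hyp(1)] by blast
    moreover have "D - 2 * K - real k * \<delta> - \<delta> \<le> gromov_product dist (\<gamma> s0) (c j) (\<gamma> s2)"
      using j(3) K nn[of k] hyp(2) gromov_product_commute[of "\<gamma> s0" "\<gamma> s2" "c j"] by linarith
    ultimately have "D - 2 * K - real k * \<delta> - \<delta> - \<delta> \<le> gromov_product dist (\<gamma> s0) (\<gamma> s1) (\<gamma> s2)"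
      by (rule four_pointD[OF hyp(1)])
    then have "D \<le> real k * \<delta> + 2 * K + 2 * \<delta> + 1" using small by linarith
    also have "real k * \<delta> \<le> (log 2 N + 1) * \<delta>" using kN hyp(2) by (rule mult_right_mono)
    finally have "D \<le> \<delta> * log 2 N + (2 * K + 3 * \<delta> + 1)" by (simp add: algebra_simps)
    then have "D \<le> D0" using D0[OF D_nn] by (simp add: N_def)
    then show "\<exists>i\<le>n. dist (\<gamma> s) (c i) \<le> D0" using near[OF s] by force
  qed
qed

text \<open>The Morse lemma. By connectedness of \<open>[0,1]\<close> some point of \<open>\<gamma>\<close> is close both to a \<open>c i\<close> with
  \<open>i \<le> t\<close> and to a \<open>c j\<close> with \<open>t \<le> j\<close>. Then \<open>c i\<close> and \<open>c j\<close> are close, so \<open>j - i\<close> is bounded and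
  \<open>c t\<close> is close to \<open>\<gamma>\<close> as well.\<close>

lemma quasi_geodesic_stability:
  assumes len: "length_space TYPE('x::metric_space)"
    and hyp: "four_point TYPE('x) \<delta>" "0 \<le> \<delta>" and K: "1 \<le> K"
  obtains R where "\<And>(c :: nat \<Rightarrow> 'x) n t. quasi_geodesic K c n \<Longrightarrow> t \<le> n \<Longrightarrow>
    gromov_product dist (c t) (c 0) (c n) \<le> R"
proof -
  obtain D0 where D0: "\<And>(c :: nat \<Rightarrow> 'x) n \<gamma> s. quasi_geodesic K c n \<Longrightarrow> path \<gamma> \<Longrightarrow> \<gamma> 0 = c 0 \<Longrightarrow> \<gamma> 1 = c n \<Longrightarrow>
     (\<And>s t u. 0 \<le> s \<Longrightarrow> s \<le> t \<Longrightarrow> t \<le> u \<Longrightarrow> u \<le> 1 \<Longrightarrow>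
       dist (\<gamma> s) (\<gamma> t) + dist (\<gamma> t) (\<gamma> u) \<le> dist (\<gamma> s) (\<gamma> u) + 1) \<Longrightarrow>
     s \<in> {0..1} \<Longrightarrow> \<exists>i\<le>n. dist (\<gamma> s) (c i) \<le> D0"
    using near_geodesic_near_quasi_geodesic[OF hyp K] by blast
  show thesis
  proof (rule that)
    fix c :: "nat \<Rightarrow> 'x" and n t
    assume qg: "quasi_geodesic K c n" and t: "t \<le> n"
    obtain \<gamma> where \<gamma>: "path \<gamma>" "\<gamma> 0 = c 0" "\<gamma> 1 = c n"
      and geo: "\<And>s t u. 0 \<le> s \<Longrightarrow> s \<le> t \<Longrightarrow> t \<le> u \<Longrightarrow> u \<le> 1 \<Longrightarrow>
       dist (\<gamma> s) (\<gamma> t) + dist (\<gamma> t) (\<gamma> u) \<le> dist (\<gamma> s) (\<gamma> u) + 1"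
      using near_geodesic_exists[OF len zero_less_one, of "c 0" "c n"] by blast
    have near: "\<exists>i\<le>n. dist (\<gamma> s) (c i) \<le> D0" if "s \<in> {0..1}" for s
      using D0[OF qg \<gamma> geo that] by blast
    \<comment> \<open>closed for finite \<open>I\<close>, as a finite union of closed sets; connectedness makes two of these sets meet\<close>
    define near_part where
      "near_part I = {s \<in> {0..1}. \<exists>i\<in>I. dist (\<gamma> s) (c i) \<le> D0}" for I
    have D0_nn: "0 \<le> D0" using near[of 0] by (force intro: order_trans[OF zero_le_dist])
    have cl: "closed (near_part I)" if "finite I" for I
    proof -
      have "closed (\<Union>i\<in>I. {s \<in> {0..1}. dist (\<gamma> s) (c i) \<le> D0})"
        using that \<gamma>(1) unfolding path_def
        by (intro closed_UN ballI continuous_on_closed_Collect_le continuous_intros) auto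
      moreover have "near_part I = (\<Union>i\<in>I. {s \<in> {0..1}. dist (\<gamma> s) (c i) \<le> D0})"
        by (auto simp: near_part_def)
      ultimately show ?thesis by simp
    qed
    have "{0..1} \<subseteq> near_part {..t} \<union> near_part {t..n}"
      using near by (force simp: near_part_def)
    moreover have "0 \<in> near_part {..t}" "1 \<in> near_part {t..n}"
      using \<gamma>(2,3) t D0_nn by (force simp: near_part_def)+
    ultimately have "near_part {..t} \<inter> near_part {t..n} \<inter> {0..1} \<noteq> {}"
      using connected_closedD[OF connected_Icc[of "0::real" 1], of "near_part {..t}" "near_part {t..n}"]
        cl by fastforce
    then obtain s where s': "s \<in> near_part {..t}" "s \<in> near_part {t..n}" by blast
    then have s: "s \<in> {0..1}" by (simp add: near_part_def)
    obtain i where i: "i \<le> t" "dist (\<gamma> s) (c i) \<le> D0"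
      using s'(1) by (auto simp: near_part_def)
    obtain j where j: "t \<le> j" "j \<le> n" "dist (\<gamma> s) (c j) \<le> D0"
      using s'(2) by (auto simp: near_part_def)
    have in_n: "i \<le> n" using i t by simp
    have "\<bar>real t - real i\<bar> \<le> \<bar>real i - real j\<bar>" using i j by simp
    also have "\<dots> \<le> K * (dist (c i) (c j) + K)"
      using quasi_geodesicD(1)[OF qg _ in_n j(2)] K by simp
    also have "\<dots> \<le> K * (2 * D0 + K)"
      using K i(2) j(3) dist_triangle3[of "c i" "c j" "\<gamma> s"] by (intro mult_left_mono) auto
    finally have "K * \<bar>real t - real i\<bar> \<le> K * (K * (2 * D0 + K))" using K by (intro mult_left_mono) auto
    moreover have "dist (c t) (c i) \<le> K * \<bar>real t - real i\<bar> + K"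
      using quasi_geodesicD(2)[OF qg _ t in_n] K by simp
    ultimately have "dist (c t) (\<gamma> s) \<le> K * (K * (2 * D0 + K)) + K + D0"
      using dist_triangle2[of "c t" "\<gamma> s" "c i"] i(2) by linarith
    moreover have "gromov_product dist (\<gamma> s) (c 0) (c n) \<le> 1 / 2"
      using geo[of 0 s 1] s \<gamma> by (simp add: gromov_product_def dist_commute)
    ultimately show "gromov_product dist (c t) (c 0) (c n) \<le> K * (K * (2 * D0 + K)) + K + D0 + 1 / 2"
      using gromov_product_perturb[of "c t" "c 0" "c n" "\<gamma> s"] by linarith
  qed
qed

text \<open>Both \<open>m\<close> and the points of \<open>c\<close> lie nearly between \<open>c 0\<close> and \<open>c n\<close>. In a hyperbolic space such
  points are determined, up to a bounded error, by their distance from \<open>c 0\<close>; the index \<open>i\<close> is the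
  last one that has not overtaken \<open>m\<close>.\<close>

lemma small_gromov_product_near_quasi_geodesic:
  fixes c :: "nat \<Rightarrow> 'x::metric_space"
  assumes hyp: "four_point TYPE('x) \<delta>" and K: "1 \<le> K" and qg: "quasi_geodesic K c n"
    and R: "\<And>t. t \<le> n \<Longrightarrow> gromov_product dist (c t) (c 0) (c n) \<le> R"
    and m: "gromov_product dist m (c 0) (c n) \<le> R"
  obtains i where "i \<le> n" "dist m (c i) \<le> 4 * K + 2 * R + 2 * \<bar>\<delta>\<bar>"
proof -
  define I where "I = {i. i \<le> n \<and> dist (c 0) (c i) \<le> dist (c 0) m}"
  have "0 \<in> I" "finite I" by (auto simp: I_def)
  then have "Max I \<in> I" by (intro Max_in) auto
  moreover define i where "i = Max I"
  ultimately have i: "i \<le> n" "dist (c 0) (c i) \<le> dist (c 0) m" by (auto simp: I_def)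
  have close: "dist m (c i) \<le> 4 * K + 2 * R + 2 * \<bar>\<delta>\<bar>"
  proof (cases "i = n")
    case True
    then show ?thesis using i m K
      by (simp add: gromov_product_def dist_commute)
  next
    case False
    then have "Suc i \<le> n" "Suc i \<notin> I"
      using i(1) Max_ge[OF \<open>finite I\<close>, of "Suc i"] by (auto simp: i_def)
    then have "dist (c 0) m < dist (c 0) (c (Suc i))" by (simp add: I_def)
    moreover have "dist (c i) (c (Suc i)) \<le> 2 * K"
      using quasi_geodesicD(2)[OF qg _ i(1) \<open>Suc i \<le> n\<close>] K by simp
    ultimately have lower: "dist (c 0) m - 2 * K \<le> dist (c 0) (c i)"
      using dist_triangle[of "c 0" "c (Suc i)" "c i"] by linarith
    have "dist (c 0) m - 2 * K - R \<le> gromov_product dist (c 0) m (c n)"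
      using m K by (simp add: gromov_product_def dist_commute)
    moreover have "dist (c 0) m - 2 * K - R \<le> gromov_product dist (c 0) (c n) (c i)"
      using R[OF i(1)] lower by (simp add: gromov_product_def dist_commute)
    ultimately have "dist (c 0) m - 2 * K - R - \<delta> \<le> gromov_product dist (c 0) m (c i)"
      by (rule four_pointD[OF hyp])
    then show ?thesis using i(2) by (simp add: gromov_product_def)
  qed
  show thesis using that i(1) close by blast
qed

section \<open>Hyperbolicity by thin triangles and its transfer\<close>

text \<open>The vertices of a connected graph with the combinatorial metric: a path in the graph that is as short as
  possible visits the integer points of a geodesic, and these suffice for the arguments with triangles.\<close>

locale discrete_geodesic_space =
  fixes M :: "'a set" and d :: "'a \<Rightarrow> 'a \<Rightarrow> real"
  assumes d_triangle: "\<And>x y z. x \<in> M \<Longrightarrow> y \<in> M \<Longrightarrow> z \<in> M \<Longrightarrow> d x z \<le> d x y + d y z"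
    and d_commute: "\<And>x y. x \<in> M \<Longrightarrow> y \<in> M \<Longrightarrow> d x y = d y x"
    and geodesic_exists: "\<And>x y. x \<in> M \<Longrightarrow> y \<in> M \<Longrightarrow> \<exists>n c. c 0 = x \<and> c n = y \<and>
      (\<forall>i\<le>n. c i \<in> M) \<and> (\<forall>i\<le>n. \<forall>j\<le>n. d (c i) (c j) = \<bar>real i - real j\<bar>)"
begin

definition geodesic :: "(nat \<Rightarrow> 'a) \<Rightarrow> nat \<Rightarrow> 'a \<Rightarrow> 'a \<Rightarrow> bool" where
  "geodesic c n x y \<longleftrightarrow> c 0 = x \<and> c n = y \<and>
     (\<forall>i\<le>n. c i \<in> M) \<and> (\<forall>i\<le>n. \<forall>j\<le>n. d (c i) (c j) = \<bar>real i - real j\<bar>)"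

lemma obtain_geodesic:
  assumes "x \<in> M" "y \<in> M"
  obtains n c where "geodesic c n x y"
  using geodesic_exists[OF assms] unfolding geodesic_def by blast

lemma geodesicD:
  assumes "geodesic c n x y" "i \<le> n"
  shows "c i \<in> M" "d x (c i) + d (c i) y = d x y"
  using assms by (auto simp: geodesic_def)

definition thin_triangles :: "real \<Rightarrow> bool" where
  "thin_triangles T \<longleftrightarrow> (\<forall>x y z c n c1 n1 c2 n2. geodesic c n x y \<and> geodesic c1 n1 x z \<and> geodesic c2 n2 z y \<longrightarrow>
     (\<forall>i\<le>n. (\<exists>j\<le>n1. d (c i) (c1 j) \<le> T) \<or> (\<exists>j\<le>n2. d (c i) (c2 j) \<le> T)))"

lemma gromov_product_le_dist_geodesic:
  assumes "geodesic c n x y" "i \<le> n" "w \<in> M" "x \<in> M" "y \<in> M"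
  shows "gromov_product d w x y \<le> d w (c i)"
  unfolding gromov_product_def
proof -
  have ci: "c i \<in> M" and eq: "d x (c i) + d (c i) y = d x y" using geodesicD[OF assms(1,2)] .
  show "(d w x + d w y - d x y) / 2 \<le> d w (c i)"
    using d_triangle[OF assms(3) ci assms(4)] d_triangle[OF assms(3) ci assms(5)]
      d_commute[OF assms(4) ci] eq by (simp add: field_simps)
qed

text \<open>Cut the side from \<open>x\<close> to \<open>y\<close> of the triangle \<open>x, y, w\<close> where it passes from the neighbourhood of
  one of the other sides to that of the other one. The point \<open>c i\<close> found there is close to both sides
  at \<open>w\<close>, so it lies nearly on shortest ways from \<open>w\<close> to \<open>x\<close> and to \<open>y\<close>.\<close>

lemma dist_geodesic_le_gromov_product:
  assumes thin: "thin_triangles T" "0 \<le> T" and c: "geodesic c n x y"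
    and M: "w \<in> M" "x \<in> M" "y \<in> M"
  obtains i where "i \<le> n" "d w (c i) \<le> gromov_product d w x y + 2 * T + 2"
proof -
  obtain c1 n1 where c1: "geodesic c1 n1 x w" using obtain_geodesic M by blast
  obtain c2 n2 where c2: "geodesic c2 n2 w y" using obtain_geodesic M by blast
  define near1 where "near1 i \<longleftrightarrow> (\<exists>j\<le>n1. d (c i) (c1 j) \<le> T + 1)" for i
  define near2 where "near2 i \<longleftrightarrow> (\<exists>j\<le>n2. d (c i) (c2 j) \<le> T)" for i
  have thin': "near2 i \<or> (\<exists>j\<le>n1. d (c i) (c1 j) \<le> T)" if "i \<le> n" for i
    using thin(1) c c1 c2 that unfolding thin_triangles_def near2_def by blast
  have "near2 n"
    unfolding near2_def using c c2 thin(2) by (intro exI[of _ n2]) (auto simp: geodesic_def)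
  define i where "i = (LEAST i. near2 i)"
  have i: "near2 i" "i \<le> n" and least: "\<And>l. l < i \<Longrightarrow> \<not> near2 l"
    using \<open>near2 n\<close> unfolding i_def by (auto intro: LeastI Least_le dest: not_less_Least)
  have "near1 i"
  proof (cases i)
    case 0
    then show ?thesis unfolding near1_def using c c1 thin(2)
      by (intro exI[of _ 0]) (auto simp: geodesic_def)
  next
    case (Suc l)
    then obtain j where j: "j \<le> n1" "d (c l) (c1 j) \<le> T" using least thin'[of l] i by auto
    have "d (c i) (c l) = 1" using c i(2) Suc by (auto simp: geodesic_def)
    then have "d (c i) (c1 j) \<le> T + 1"
      using d_triangle[of "c i" "c l" "c1 j"] j geodesicD(1)[OF c, of l] geodesicD(1)[OF c, of i]
        geodesicD(1)[OF c1, of j] i Suc by simp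
    then show ?thesis using j(1) unfolding near1_def by blast
  qed
  then obtain j1 where j1: "j1 \<le> n1" "d (c i) (c1 j1) \<le> T + 1" by (auto simp: near1_def)
  obtain j2 where j2: "j2 \<le> n2" "d (c i) (c2 j2) \<le> T" using i(1) by (auto simp: near2_def)
  have ci: "c i \<in> M" and p1: "c1 j1 \<in> M" and p2: "c2 j2 \<in> M"
    using geodesicD(1) c c1 c2 i(2) j1(1) j2(1) by blast+
  have "d w (c i) \<le> d w (c1 j1) + (T + 1)"
    using d_triangle[OF M(1) p1 ci] d_commute[OF ci p1] j1(2) by linarith
  moreover have "d x (c i) \<le> d x (c1 j1) + (T + 1)"
    using d_triangle[OF M(2) p1 ci] d_commute[OF ci p1] j1(2) by linarith
  moreover have "d x (c1 j1) + d w (c1 j1) = d w x"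
    using geodesicD(2)[OF c1 j1(1)] d_commute[OF M(1) p1] d_commute[OF M(1,2)] by linarith
  ultimately have a: "d w (c i) + d x (c i) \<le> d w x + 2 * T + 2" by linarith
  have "d w (c i) \<le> d w (c2 j2) + T"
    using d_triangle[OF M(1) p2 ci] d_commute[OF ci p2] j2(2) by linarith
  moreover have "d (c i) y \<le> d (c2 j2) y + T"
    using d_triangle[OF ci p2 M(3)] j2(2) by linarith
  moreover have "d w (c2 j2) + d (c2 j2) y = d w y"
    using geodesicD(2)[OF c2 j2(1)] .
  ultimately have b: "d w (c i) + d (c i) y \<le> d w y + 2 * T" by linarith
  show thesis
  proof (rule that[OF i(2)])
    have "2 * gromov_product d w x y = d w x + d w y - d x y" by (simp add: gromov_product_def)
    then show "d w (c i) \<le> gromov_product d w x y + 2 * T + 2"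
      using a b geodesicD(2)[OF c i(2)] \<open>0 \<le> T\<close> by linarith
  qed
qed

text \<open>By the two preceding estimates the Gromov product at \<open>w\<close> is, up to a constant, the distance from \<open>w\<close>
  to a geodesic, and for these distances the four-point condition is immediate from thinness.\<close>

lemma thin_triangles_imp_hyperbolic:
  assumes thin: "thin_triangles T" "0 \<le> T"
  shows "gromov_hyperbolic M d"
  unfolding gromov_hyperbolic_def
proof (intro exI[of _ "3 * T + 2"] conjI ballI)
  fix w x y z assume M: "w \<in> M" "x \<in> M" "y \<in> M" "z \<in> M"
  obtain c n where c: "geodesic c n x y" using obtain_geodesic M by blast
  obtain c1 n1 where c1: "geodesic c1 n1 x z" using obtain_geodesic M by blast
  obtain c2 n2 where c2: "geodesic c2 n2 z y" using obtain_geodesic M by blast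
  obtain i where i: "i \<le> n" "d w (c i) \<le> gromov_product d w x y + 2 * T + 2"
    using dist_geodesic_le_gromov_product[OF thin c] M by blast
  have ci: "c i \<in> M" using geodesicD(1)[OF c i(1)] .
  have "(\<exists>j\<le>n1. d (c i) (c1 j) \<le> T) \<or> (\<exists>j\<le>n2. d (c i) (c2 j) \<le> T)"
    using thin(1) c c1 c2 i(1) unfolding thin_triangles_def by blast
  then show "min (gromov_product d w x z) (gromov_product d w z y) - (3 * T + 2) \<le> gromov_product d w x y"
  proof (elim disjE exE conjE)
    fix j assume j: "j \<le> n1" "d (c i) (c1 j) \<le> T"
    have "gromov_product d w x z \<le> d w (c1 j)"
      by (rule gromov_product_le_dist_geodesic[OF c1 j(1) M(1,2,4)])
    also have "\<dots> \<le> d w (c i) + T"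
      using d_triangle[OF M(1) ci geodesicD(1)[OF c1 j(1)]] j(2) by linarith
    finally show ?thesis using i(2) by linarith
  next
    fix j assume j: "j \<le> n2" "d (c i) (c2 j) \<le> T"
    have "gromov_product d w z y \<le> d w (c2 j)"
      by (rule gromov_product_le_dist_geodesic[OF c2 j(1) M(1,4,3)])
    also have "\<dots> \<le> d w (c i) + T"
      using d_triangle[OF M(1) ci geodesicD(1)[OF c2 j(1)]] j(2) by linarith
    finally show ?thesis using i(2) by linarith
  qed
qed (use thin in simp)

text \<open>The image of a geodesic is a quasi-geodesic, so \<open>c i\<close> has small Gromov product with respect to the
  ends of its side. By the four-point condition in the target it has small Gromov product with respect
  to the ends of one of the other two sides, and is therefore close to that side.\<close>

lemma hyperbolic_if_quasi_isometric_embedding: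
  fixes f :: "'a \<Rightarrow> 'x::metric_space"
  assumes len: "length_space TYPE('x)" and hyp: "gromov_hyperbolic (UNIV :: 'x set) dist"
    and K: "1 \<le> K"
    and qi: "\<And>x y. x \<in> M \<Longrightarrow> y \<in> M \<Longrightarrow> d x y / K - K \<le> dist (f x) (f y)"
      "\<And>x y. x \<in> M \<Longrightarrow> y \<in> M \<Longrightarrow> dist (f x) (f y) \<le> K * d x y + K"
  shows "gromov_hyperbolic M d"
proof -
  obtain \<delta> where \<delta>: "0 \<le> \<delta>" "four_point TYPE('x) \<delta>"
    using hyp unfolding gromov_hyperbolic_def four_point_def by auto
  obtain R where R: "\<And>(c :: nat \<Rightarrow> 'x) n t. quasi_geodesic K c n \<Longrightarrow> t \<le> n \<Longrightarrow>
      gromov_product dist (c t) (c 0) (c n) \<le> R"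
    using quasi_geodesic_stability[OF len \<delta>(2,1) K] by blast
  define R' where "R' = R + \<delta>"
  define T where "T = K * ((4 * K + 2 * R' + 2 * \<bar>\<delta>\<bar>) + K)"
  have qg: "quasi_geodesic K (\<lambda>i. f (c i)) n" if "geodesic c n x y" for c n x y
    unfolding quasi_geodesic_def
  proof (intro allI impI)
    fix i j assume "i \<le> n" "j \<le> n"
    then have "c i \<in> M" "c j \<in> M" "d (c i) (c j) = \<bar>real i - real j\<bar>"
      using that by (auto simp: geodesic_def)
    then show "\<bar>real i - real j\<bar> / K - K \<le> dist (f (c i)) (f (c j)) \<and>
        dist (f (c i)) (f (c j)) \<le> K * \<bar>real i - real j\<bar> + K"
      using qi[of "c i" "c j"] by simp
  qed
  have R_geo: "gromov_product dist (f (c i)) (f x) (f y) \<le> R" if "geodesic c n x y" "i \<le> n" for c n x y i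
    using R[OF qg[OF that(1)] that(2)] that(1) by (simp add: geodesic_def)
  have close: "\<exists>j\<le>n. d m (c j) \<le> T"
    if c: "geodesic c n x y" and m: "m \<in> M" "gromov_product dist (f m) (f x) (f y) \<le> R'" for c n x y m
  proof -
    have "gromov_product dist (f (c t)) (f (c 0)) (f (c n)) \<le> R'" if "t \<le> n" for t
      using R[OF qg[OF c] that] \<delta>(1) by (simp add: R'_def)
    moreover have "gromov_product dist (f m) (f (c 0)) (f (c n)) \<le> R'"
      using m c by (simp add: geodesic_def)
    ultimately obtain j where j: "j \<le> n" "dist (f m) (f (c j)) \<le> 4 * K + 2 * R' + 2 * \<bar>\<delta>\<bar>"
      using small_gromov_product_near_quasi_geodesic[OF \<delta>(2) K qg[OF c], of R' "f m"] by blast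
    have "d m (c j) / K \<le> (4 * K + 2 * R' + 2 * \<bar>\<delta>\<bar>) + K"
      using qi(1)[OF m(1) geodesicD(1)[OF c j(1)]] j(2) by linarith
    then have "d m (c j) \<le> T" using K by (simp add: T_def divide_le_eq mult.commute)
    then show ?thesis using j(1) by blast
  qed
  have "thin_triangles (max T 0)"
    unfolding thin_triangles_def
  proof (intro allI impI, elim conjE)
    fix x y z c n c1 n1 c2 n2 i
    assume c: "geodesic c n x y" and c1: "geodesic c1 n1 x z" and c2: "geodesic c2 n2 z y"
      and i: "i \<le> n"
    have ci: "c i \<in> M" using geodesicD(1)[OF c i] .
    have "gromov_product dist (f (c i)) (f x) (f z) \<le> R' \<or> gromov_product dist (f (c i)) (f z) (f y) \<le> R'"
    proof (rule ccontr)
      assume "\<not> ?thesis"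
      then have "min (gromov_product dist (f (c i)) (f x) (f z)) (gromov_product dist (f (c i)) (f z) (f y)) > R + \<delta>"
        by (simp add: R'_def)
      moreover have "min (gromov_product dist (f (c i)) (f x) (f z)) (gromov_product dist (f (c i)) (f z) (f y)) - \<delta>
          \<le> gromov_product dist (f (c i)) (f x) (f y)"
        using \<delta>(2) unfolding four_point_def by blast
      ultimately show False using R_geo[OF c i] by linarith
    qed
    then show "(\<exists>j\<le>n1. d (c i) (c1 j) \<le> max T 0) \<or> (\<exists>j\<le>n2. d (c i) (c2 j) \<le> max T 0)"
      using close[OF c1 ci] close[OF c2 ci] by (auto simp: le_max_iff_disj)
  qed
  then show ?thesis using thin_triangles_imp_hyperbolic by simp
qed

end

lemma gromov_hyperbolic_pullback:
  assumes "gromov_hyperbolic M d" "h ` M' \<subseteq> M"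
    and close: "\<And>x y. x \<in> M' \<Longrightarrow> y \<in> M' \<Longrightarrow> \<bar>d' x y - d (h x) (h y)\<bar> \<le> C"
  shows "gromov_hyperbolic M' d'"
proof -
  obtain \<delta> where \<delta>: "0 \<le> \<delta>" "\<And>w x y z. w \<in> M \<Longrightarrow> x \<in> M \<Longrightarrow> y \<in> M \<Longrightarrow> z \<in> M \<Longrightarrow>
      min (gromov_product d w x z) (gromov_product d w z y) - \<delta> \<le> gromov_product d w x y"
    using assms(1) unfolding gromov_hyperbolic_def by blast
  define g where "g = gromov_product d'"
  define g' where "g' w x y = gromov_product d (h w) (h x) (h y)" for w x y
  have gp: "g w x y \<le> g' w x y + 3 / 2 * C" "g' w x y \<le> g w x y + 3 / 2 * C"
    if "w \<in> M'" "x \<in> M'" "y \<in> M'" for w x y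
  proof -
    have "2 * g w x y = d' w x + d' w y - d' x y"
      "2 * g' w x y = d (h w) (h x) + d (h w) (h y) - d (h x) (h y)"
      by (simp_all add: g_def g'_def gromov_product_def)
    then show "g w x y \<le> g' w x y + 3 / 2 * C" "g' w x y \<le> g w x y + 3 / 2 * C"
      using close[OF that(1,2)] close[OF that(1,3)] close[OF that(2,3)] by linarith+
  qed
  have "min (g w x z) (g w z y) - (\<delta> + 3 * C) \<le> g w x y"
    if w: "w \<in> M'" and x: "x \<in> M'" and y: "y \<in> M'" and z: "z \<in> M'" for w x y z
  proof -
    have "min (g' w x z) (g' w z y) - \<delta> \<le> g' w x y"
      unfolding g'_def using assms(2) that by (intro \<delta>(2)) auto
    moreover have "min (g w x z) (g w z y) \<le> min (g' w x z) (g' w z y) + 3 / 2 * C"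
      using gp(1)[OF w x z] gp(1)[OF w z y] by linarith
    ultimately show ?thesis using gp(2)[OF w x y] by linarith
  qed
  moreover have "0 \<le> C" if "x \<in> M'" for x
    using close[OF that that] by linarith
  ultimately show ?thesis unfolding gromov_hyperbolic_def g_def[symmetric] using \<delta>(1)
    by (intro exI[of _ "if M' = {} then 0 else \<delta> + 3 * C"]) (auto simp: add_nonneg_nonneg)
qed

section \<open>Combinatorial distance of a connected graph\<close>

definition hops :: "('a \<Rightarrow> 'a \<Rightarrow> bool) \<Rightarrow> 'a \<Rightarrow> 'a \<Rightarrow> nat" where
  "hops R x y = (LEAST n. (R ^^ n) x y)"

lemma hops_le: "(R ^^ n) x y \<Longrightarrow> hops R x y \<le> n"
  unfolding hops_def by (rule Least_le)

text \<open>The graph with vertex set \<open>M\<close> and edges \<open>R\<close>; \<open>hops\<close> is its combinatorial distance.\<close>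

locale connected_relation =
  fixes M :: "'a set" and R :: "'a \<Rightarrow> 'a \<Rightarrow> bool"
  assumes relation_on: "\<And>x y. R x y \<Longrightarrow> x \<in> M \<and> y \<in> M"
    and relation_sym: "\<And>x y. R x y \<Longrightarrow> R y x"
    and connected: "\<And>x y. x \<in> M \<Longrightarrow> y \<in> M \<Longrightarrow> \<exists>n. (R ^^ n) x y"
begin

lemma hops_attained: "x \<in> M \<Longrightarrow> y \<in> M \<Longrightarrow> (R ^^ hops R x y) x y"
  unfolding hops_def using connected by (rule LeastI_ex)

lemma hops_triangle:
  assumes "x \<in> M" "y \<in> M" "z \<in> M"
  shows "hops R x z \<le> hops R x y + hops R y z"
  using hops_attained[OF assms(1,2)] hops_attained[OF assms(2,3)]
  by (intro hops_le) (auto simp: relpowp_add)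

lemma relpowp_sym: "(R ^^ n) x y \<Longrightarrow> (R ^^ n) y x"
proof (induction n arbitrary: x y)
  case (Suc n)
  then obtain z where "(R ^^ n) x z" "R z y" by auto
  then show ?case using Suc.IH relation_sym by (meson relpowp_Suc_I2)
qed simp

lemma hops_commute:
  assumes "x \<in> M" "y \<in> M"
  shows "hops R x y = hops R y x"
  using hops_attained[OF assms] hops_attained[OF assms(2,1)] relpowp_sym
  by (meson hops_le order_antisym)

lemma hops_self [simp]: "hops R x x = 0"
  using hops_le[of 0 R x x] by simp

sublocale discrete_geodesic_space M "\<lambda>x y. real (hops R x y)"
proof
  fix x y z assume "x \<in> M" "y \<in> M" "z \<in> M"
  then show "real (hops R x z) \<le> real (hops R x y) + real (hops R y z)"
    using hops_triangle by (metis of_nat_add of_nat_le_iff)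
next
  fix x y assume M: "x \<in> M" "y \<in> M"
  then show "real (hops R x y) = real (hops R y x)" using hops_commute by simp
  define n where "n = hops R x y"
  have "(R ^^ n) x y" using hops_attained M by (simp add: n_def)
  then obtain c where c: "c 0 = x" "c n = y" "\<And>i. i < n \<Longrightarrow> R (c i) (c (Suc i))"
    unfolding relpowp_fun_conv by blast
  have cM: "c i \<in> M" if "i \<le> n" for i
    using that c(1) M relation_on[OF c(3), of "i - 1"] by (cases i) auto
  have upper: "hops R (c i) (c (i + k)) \<le> k" if "i + k \<le> n" for i k
    using that c(3) by (intro hops_le) (auto simp: relpowp_fun_conv intro!: exI[of _ "\<lambda>l. c (i + l)"])
  have eq: "hops R (c i) (c j) = j - i" if "i \<le> j" "j \<le> n" for i j
  proof -
    have "n \<le> hops R (c 0) (c i) + (hops R (c i) (c j) + hops R (c j) (c n))"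
      using hops_triangle[of "c 0" "c i" "c n"] hops_triangle[of "c i" "c j" "c n"] that c(1,2) cM[of i] cM[of j] M
      by (simp add: n_def)
    moreover have "hops R (c 0) (c i) \<le> i" "hops R (c i) (c j) \<le> j - i" "hops R (c j) (c n) \<le> n - j"
      using upper[of 0 i] upper[of i "j - i"] upper[of j "n - j"] that by simp_all
    ultimately show ?thesis using that by linarith
  qed
  have "real (hops R (c i) (c j)) = \<bar>real i - real j\<bar>" if ij: "i \<le> n" "j \<le> n" for i j
  proof (cases "i \<le> j")
    case True
    then show ?thesis using eq[OF True ij(2)] by (simp add: of_nat_diff)
  next
    case False
    then show ?thesis using eq[of j i] ij hops_commute[of "c i" "c j"] cM by (simp add: of_nat_diff)
  qed
  then show "\<exists>n c. c 0 = x \<and> c n = y \<and> (\<forall>i\<le>n. c i \<in> M) \<and>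
      (\<forall>i\<le>n. \<forall>j\<le>n. real (hops R (c i) (c j)) = \<bar>real i - real j\<bar>)"
    using c(1,2) cM by blast
qed

end

section \<open>The coned-off graph and the coned-off word metric\<close>

lemma walk_append:
  assumes "walk \<Gamma> u L v" "walk \<Gamma> v L' w"
  shows "walk \<Gamma> u (L + L') w"
  using assms
proof (induction rule: walk.induct)
  case (walk_fwd e L v)
  then show ?case using walk.walk_fwd[of e \<Gamma> "L + L'" w] by (simp add: add.assoc)
next
  case (walk_bwd e L v)
  then show ?case using walk.walk_bwd[of e \<Gamma> "L + L'" w] by (simp add: add.assoc)
qed simp

text \<open>A cone vertex stands for all elements of its coset, and \<open>slack\<close> is the length of the edge to any of
  them. Used as a potential, the slack makes entering a cone free of charge and leaving it cost one
  \<open>cone_step\<close>, so that the comparison of walks with \<open>cone_step\<close> accumulates no error.\<close>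

fun members :: "'g cone_vertex \<Rightarrow> 'g set" where
  "members (Elem g) = {g}"
| "members (Cone C) = C"

fun slack :: "'g cone_vertex \<Rightarrow> real" where
  "slack (Elem g) = 0"
| "slack (Cone C) = 1 / 2"

lemma slack_bounds: "0 \<le> slack u" "slack u \<le> 1 / 2"
  by (cases u; simp)+

locale coned_off = group G for G (structure) +
  fixes S :: "'a set" and \<H> :: "'a set set"
  assumes S: "S \<subseteq> carrier G" "generate G S = carrier G"
    and \<H>: "\<And>H. H \<in> \<H> \<Longrightarrow> subgroup H G"
begin

definition cone_generators :: "'a set" where
  "cone_generators = S \<union> m_inv G ` S \<union> \<Union>\<H>"

definition cone_step :: "'a \<Rightarrow> 'a \<Rightarrow> bool" where
  "cone_step g h \<longleftrightarrow> g \<in> carrier G \<and> h \<in> carrier G \<and> inv g \<otimes> h \<in> cone_generators"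

abbreviation cone_dist :: "'a \<Rightarrow> 'a \<Rightarrow> nat" where
  "cone_dist \<equiv> hops cone_step"

abbreviation cone_graph :: "('a cone_vertex, 'a cone_edge) metric_graph" where
  "cone_graph \<equiv> coned_off_cayley_graph G S \<H>"

lemma cone_generators_closed: "cone_generators \<subseteq> carrier G"
  using S(1) \<H> by (auto simp: cone_generators_def dest: subgroup.subset)

lemma cone_generators_inv: "t \<in> cone_generators \<Longrightarrow> inv t \<in> cone_generators"
proof -
  assume "t \<in> cone_generators"
  then consider "t \<in> S" | s where "s \<in> S" "t = inv s" | H where "H \<in> \<H>" "t \<in> H"
    unfolding cone_generators_def by blast
  then show ?thesis
  proof cases
    case 1
    then show ?thesis unfolding cone_generators_def by blast
  next
    case 2
    then have "inv t = s" using S(1) by (simp add: subsetD)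
    then show ?thesis using 2 unfolding cone_generators_def by blast
  next
    case 3
    then show ?thesis using subgroup.m_inv_closed[OF \<H>] unfolding cone_generators_def by blast
  qed
qed

lemma cone_stepI:
  assumes "g \<in> carrier G" "t \<in> cone_generators"
  shows "cone_step g (g \<otimes> t)"
  using assms cone_generators_closed by (auto simp: cone_step_def m_assoc[symmetric] subsetD)

text \<open>Every element is a product of elements of \<open>S\<close> and their inverses, and each factor is one step.\<close>

lemma cone_step_power:
  assumes "t \<in> generate G S" "g \<in> carrier G"
  shows "\<exists>n. (cone_step ^^ n) g (g \<otimes> t)"
  using assms
proof (induction arbitrary: g rule: generate.induct)
  case one
  then show ?case by (intro exI[of _ 0]) simp
next
  case (incl s)
  then have "cone_step g (g \<otimes> s)" by (intro cone_stepI) (auto simp: cone_generators_def)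
  then have "(cone_step ^^ 1) g (g \<otimes> s)" by (simp only: relpowp_1)
  then show ?case by (rule exI)
next
  case (inv s)
  then have "cone_step g (g \<otimes> inv s)" by (intro cone_stepI) (auto simp: cone_generators_def)
  then have "(cone_step ^^ 1) g (g \<otimes> inv s)" by (simp only: relpowp_1)
  then show ?case by (rule exI)
next
  case (eng s t)
  have st: "s \<in> carrier G" "t \<in> carrier G" using eng.hyps S by auto
  obtain n m where "(cone_step ^^ n) g (g \<otimes> s)" "(cone_step ^^ m) (g \<otimes> s) (g \<otimes> s \<otimes> t)"
    using eng.IH(1)[OF eng.prems] eng.IH(2)[of "g \<otimes> s"] eng.prems st by auto
  then have "(cone_step ^^ (n + m)) g (g \<otimes> s \<otimes> t)" by (auto simp: relpowp_add)
  then show ?case using st eng.prems by (auto simp: m_assoc)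
qed

sublocale connected_relation "carrier G" cone_step
proof
  fix g h assume gh: "cone_step g h"
  then show "g \<in> carrier G \<and> h \<in> carrier G" by (simp add: cone_step_def)
  have "inv h \<otimes> g = inv (inv g \<otimes> h)" using gh by (simp add: cone_step_def inv_mult_group)
  then show "cone_step h g" using gh cone_generators_inv by (auto simp: cone_step_def)
next
  fix g h assume "g \<in> carrier G" "h \<in> carrier G"
  then show "\<exists>n. (cone_step ^^ n) g h"
    using cone_step_power[of "inv g \<otimes> h" g] S by (simp add: m_assoc[symmetric])
qed

lemma cone_step_hops: "cone_step g h \<Longrightarrow> cone_dist g h \<le> 1"
  using hops_le[of 1 cone_step g h, unfolded relpowp_1] by blast

lemma left_cosets_iff: "C \<in> left_cosets G \<H> \<longleftrightarrow> (\<exists>H\<in>\<H>. \<exists>a\<in>carrier G. C = a <# H)"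
  by (auto simp: left_cosets_def LCOSETS_def)

lemma coset_step:
  assumes "C \<in> left_cosets G \<H>" "g \<in> C" "h \<in> C"
  shows "cone_step g h"
proof -
  obtain H a where H: "H \<in> \<H>" "a \<in> carrier G" "C = a <# H" using assms(1) left_cosets_iff by blast
  interpret H: subgroup H G using \<H> H(1) .
  obtain x y where xy: "x \<in> H" "y \<in> H" "g = a \<otimes> x" "h = a \<otimes> y"
    using assms(2,3) H(3) by (auto simp: l_coset_def)
  have "inv g \<otimes> h = inv x \<otimes> y"
    using xy H(2) by (simp add: inv_mult_group m_assoc) (simp add: m_assoc[symmetric])
  moreover have "inv x \<otimes> y \<in> H" using xy by simp
  ultimately have "inv g \<otimes> h \<in> cone_generators"
    using H(1) unfolding cone_generators_def by auto
  then show ?thesis using xy H(2) by (auto simp: cone_step_def)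
qed

lemma coset_nonempty: "C \<in> left_cosets G \<H> \<Longrightarrow> C \<noteq> {}"
  using \<H> subgroup.one_closed unfolding left_cosets_iff l_coset_def by fastforce

lemma coset_carrier: "C \<in> left_cosets G \<H> \<Longrightarrow> g \<in> C \<Longrightarrow> g \<in> carrier G"
  using coset_step[of C g g] by (simp add: cone_step_def)

lemma members_carrier: "u \<in> verts cone_graph \<Longrightarrow> g \<in> members u \<Longrightarrow> g \<in> carrier G"
  by (auto simp: coned_off_cayley_graph_def coset_carrier)

lemma members_nonempty: "u \<in> verts cone_graph \<Longrightarrow> members u \<noteq> {}"
  by (auto simp: coned_off_cayley_graph_def coset_nonempty)

lemma members_close:
  "u \<in> verts cone_graph \<Longrightarrow> g \<in> members u \<Longrightarrow> h \<in> members u \<Longrightarrow> real (cone_dist g h) \<le> 2 * slack u"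
  using coset_step cone_step_hops by (fastforce simp: coned_off_cayley_graph_def)

lemma edge_cases:
  assumes "e \<in> edges cone_graph"
  obtains (Cayley) g s where "g \<in> carrier G" "s \<in> S" "src cone_graph e = Elem g"
      "tgt cone_graph e = Elem (g \<otimes> s)" "len cone_graph e = 1"
  | (Cone) C g where "C \<in> left_cosets G \<H>" "g \<in> C" "src cone_graph e = Cone C"
      "tgt cone_graph e = Elem g" "len cone_graph e = 1 / 2"
  using assms by (auto simp: coned_off_cayley_graph_def)

lemma edge_verts:
  assumes "e \<in> edges cone_graph"
  shows "src cone_graph e \<in> verts cone_graph" "tgt cone_graph e \<in> verts cone_graph"
  using assms S(1) coset_carrier by (auto simp: coned_off_cayley_graph_def)

lemma edge_close:
  assumes "e \<in> edges cone_graph" "g \<in> members (src cone_graph e)" "h \<in> members (tgt cone_graph e)"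
  shows "cone_dist g h \<le> 1"
  using assms(1)
proof (cases rule: edge_cases)
  case (Cayley g' s)
  then show ?thesis using assms cone_stepI[of g s] by (intro cone_step_hops) (auto simp: cone_generators_def)
next
  case (Cone C g')
  then show ?thesis using assms coset_step by (intro cone_step_hops) auto
qed

lemma edge_forward:
  assumes "e \<in> edges cone_graph" "g \<in> members (src cone_graph e)"
  obtains g' where "g' \<in> members (tgt cone_graph e)"
    "real (cone_dist g g') \<le> len cone_graph e + slack (src cone_graph e) - slack (tgt cone_graph e)"
proof -
  from edge_verts(2)[OF assms(1)] obtain g' where g': "g' \<in> members (tgt cone_graph e)"
    using members_nonempty by blast
  have "real (cone_dist g g') \<le> 1" using edge_close[OF assms g'] by simp
  also have "1 \<le> len cone_graph e + slack (src cone_graph e) - slack (tgt cone_graph e)"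
    using assms(1) by (cases rule: edge_cases) simp_all
  finally show thesis using that g' by blast
qed

lemma edge_backward:
  assumes e: "e \<in> edges cone_graph" "g \<in> members (tgt cone_graph e)"
  obtains g' where "g' \<in> members (src cone_graph e)"
    "real (cone_dist g g') \<le> len cone_graph e + slack (tgt cone_graph e) - slack (src cone_graph e)"
  using e(1)
proof (cases rule: edge_cases)
  case (Cayley a s)
  then have a: "a \<in> members (src cone_graph e)" by simp
  have "cone_dist g a = cone_dist a g"
    using members_carrier edge_verts[OF e(1)] a e(2) by (intro hops_commute) blast+
  also have "\<dots> \<le> 1" by (rule edge_close[OF e(1) a e(2)])
  finally show ?thesis using that[OF a] Cayley by simp
next
  case (Cone C a)
  then show ?thesis using that[of g] e(2) by simp
qed

text \<open>The slack of an intermediate vertex is subtracted when the walk arrives there and added when it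
  leaves, so only those of the two ends remain.\<close>

lemma cone_dist_le_walk:
  assumes "walk cone_graph u L v" "h \<in> members v" "v \<in> verts cone_graph" "g \<in> members u"
  shows "real (cone_dist g h) \<le> L + slack u + slack v"
  using assms
proof (induction arbitrary: g rule: walk.induct)
  case (walk_nil v)
  then show ?case using members_close[of v g h] by simp
next
  case (walk_fwd e L v)
  obtain g' where g': "g' \<in> members (tgt cone_graph e)"
    "real (cone_dist g g') \<le> len cone_graph e + slack (src cone_graph e) - slack (tgt cone_graph e)"
    using edge_forward[OF walk_fwd.hyps(1) walk_fwd.prems(3)] by blast
  have "real (cone_dist g' h) \<le> L + slack (tgt cone_graph e) + slack v"
    using walk_fwd.IH[OF walk_fwd.prems(1,2) g'(1)] .
  moreover have "cone_dist g h \<le> cone_dist g g' + cone_dist g' h"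
    using walk_fwd.prems walk_fwd.hyps(1) g'(1) edge_verts members_carrier
    by (intro hops_triangle) blast+
  ultimately show ?case using g'(2) by linarith
next
  case (walk_bwd e L v)
  obtain g' where g': "g' \<in> members (src cone_graph e)"
    "real (cone_dist g g') \<le> len cone_graph e + slack (tgt cone_graph e) - slack (src cone_graph e)"
    using edge_backward[OF walk_bwd.hyps(1) walk_bwd.prems(3)] by blast
  have "real (cone_dist g' h) \<le> L + slack (src cone_graph e) + slack v"
    using walk_bwd.IH[OF walk_bwd.prems(1,2) g'(1)] .
  moreover have "cone_dist g h \<le> cone_dist g g' + cone_dist g' h"
    using walk_bwd.prems walk_bwd.hyps(1) g'(1) edge_verts members_carrier
    by (intro hops_triangle) blast+
  ultimately show ?case using g'(2) by linarith
qed

lemma Elem_vert: "g \<in> carrier G \<Longrightarrow> Elem g \<in> verts cone_graph"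
  by (simp add: coned_off_cayley_graph_def)

lemma walk_Cayley_edge:
  assumes "g \<in> carrier G" "s \<in> S"
  shows "walk cone_graph (Elem g) 1 (Elem (g \<otimes> s))" "walk cone_graph (Elem (g \<otimes> s)) 1 (Elem g)"
proof -
  have e: "Cayley_edge g s \<in> edges cone_graph" using assms by (auto simp: coned_off_cayley_graph_def)
  have "Elem (g \<otimes> s) \<in> verts cone_graph" "Elem g \<in> verts cone_graph"
    using edge_verts[OF e] by (simp_all add: coned_off_cayley_graph_def)
  then show "walk cone_graph (Elem g) 1 (Elem (g \<otimes> s))" "walk cone_graph (Elem (g \<otimes> s)) 1 (Elem g)"
    using walk_fwd[OF e, of 0 "Elem (g \<otimes> s)"] walk_bwd[OF e, of 0 "Elem g"] walk_nil
    by (force simp: coned_off_cayley_graph_def)+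
qed

lemma walk_Cone_edge:
  assumes "C \<in> left_cosets G \<H>" "g \<in> C"
  shows "walk cone_graph (Cone C) (1 / 2) (Elem g)" "walk cone_graph (Elem g) (1 / 2) (Cone C)"
proof -
  have e: "Cone_edge C g \<in> edges cone_graph" using assms by (auto simp: coned_off_cayley_graph_def)
  have "Elem g \<in> verts cone_graph" "Cone C \<in> verts cone_graph"
    using edge_verts[OF e] by (simp_all add: coned_off_cayley_graph_def)
  then show "walk cone_graph (Cone C) (1 / 2) (Elem g)" "walk cone_graph (Elem g) (1 / 2) (Cone C)"
    using walk_fwd[OF e, of 0 "Elem g"] walk_bwd[OF e, of 0 "Cone C"] walk_nil
    by (force simp: coned_off_cayley_graph_def)+
qed

lemma cone_step_walk:
  assumes "cone_step g h"
  shows "walk cone_graph (Elem g) 1 (Elem h)"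
proof -
  have gh: "g \<in> carrier G" "h \<in> carrier G" and t: "inv g \<otimes> h \<in> cone_generators"
    using assms by (auto simp: cone_step_def)
  have h: "g \<otimes> (inv g \<otimes> h) = h" using gh by (simp add: m_assoc[symmetric])
  from t consider "inv g \<otimes> h \<in> S" | s where "s \<in> S" "inv g \<otimes> h = inv s"
    | H where "H \<in> \<H>" "inv g \<otimes> h \<in> H"
    by (auto simp: cone_generators_def)
  then show ?thesis
  proof cases
    case 1
    then show ?thesis using walk_Cayley_edge(1)[OF gh(1) 1] h by simp
  next
    case 2
    have "s \<in> carrier G" using 2(1) S by auto
    then have "h \<otimes> s = g" using h 2 gh by (metis inv_closed inv_solve_right m_closed)
    then show ?thesis using walk_Cayley_edge(2)[OF gh(2) 2(1)] by simp
  next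
    case 3
    define C where "C = g <# H"
    have C: "C \<in> left_cosets G \<H>" using 3 gh by (auto simp: C_def left_cosets_iff)
    have "\<one> \<in> H" using \<H>[OF 3(1)] by (rule subgroup.one_closed)
    then have "g \<otimes> \<one> \<in> C" unfolding C_def l_coset_def by blast
    moreover have "g \<otimes> (inv g \<otimes> h) \<in> C" using 3 unfolding C_def l_coset_def by blast
    ultimately show ?thesis
      using walk_append[OF walk_Cone_edge(2)[OF C] walk_Cone_edge(1)[OF C], of g h] h gh by simp
  qed
qed

lemma cone_dist_walk:
  assumes "g \<in> carrier G" "h \<in> carrier G"
  shows "walk cone_graph (Elem g) (real (cone_dist g h)) (Elem h)"
proof -
  have "walk cone_graph (Elem g) (real n) (Elem h)" if "(cone_step ^^ n) g h" "g \<in> carrier G" for n h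
    using that
  proof (induction n arbitrary: h)
    case 0
    then show ?case using Elem_vert walk_nil by fastforce
  next
    case (Suc n)
    then obtain k where k: "(cone_step ^^ n) g k" "cone_step k h" by auto
    then show ?case using walk_append[OF Suc.IH[OF k(1) Suc.prems(2)] cone_step_walk[OF k(2)]] by (simp add: add.commute)
  qed
  then show ?thesis using hops_attained assms by blast
qed

lemma walk_member:
  assumes "u \<in> verts cone_graph" "g \<in> members u"
  shows "walk cone_graph u (slack u) (Elem g)" "walk cone_graph (Elem g) (slack u) u"
proof -
  have "walk cone_graph u (slack u) (Elem g) \<and> walk cone_graph (Elem g) (slack u) u"
  proof (cases u)
    case (Elem g)
    then show ?thesis using assms walk_nil by auto
  next
    case (Cone C)
    then have "C \<in> left_cosets G \<H>" using assms(1) by (auto simp: coned_off_cayley_graph_def)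
    then show ?thesis using walk_Cone_edge assms(2) Cone by auto
  qed
  then show "walk cone_graph u (slack u) (Elem g)" "walk cone_graph (Elem g) (slack u) u" by auto
qed

text \<open>The target of an edge is always a group element, so an interior point is moved to that one.\<close>

fun nearby_element :: "('a cone_vertex, 'a cone_edge) gpoint \<Rightarrow> 'a" where
  "nearby_element (Vertex v) = (SOME g. g \<in> members v)"
| "nearby_element (Inner e t) = (SOME g. g \<in> members (tgt cone_graph e))"

lemma realisation_cases:
  assumes "p \<in> realisation cone_graph"
  obtains (Vertex) v where "v \<in> verts cone_graph" "p = Vertex v" "nearby_element p \<in> members v"
  | (Inner) e t where "e \<in> edges cone_graph" "p = Inner e t" "0 < t" "t < len cone_graph e"
      "nearby_element p \<in> members (tgt cone_graph e)"
proof -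
  from assms consider v where "v \<in> verts cone_graph" "p = Vertex v"
    | e t where "e \<in> edges cone_graph" "p = Inner e t" "0 < t" "t < len cone_graph e"
    unfolding realisation_def by blast
  then show thesis
  proof cases
    case 1
    then show ?thesis using Vertex members_nonempty[OF 1(1)] by (simp add: some_in_eq)
  next
    case 2
    then show ?thesis using Inner members_nonempty[OF edge_verts(2)[OF 2(1)]] by (simp add: some_in_eq)
  qed
qed

lemma nearby_element_carrier: "p \<in> realisation cone_graph \<Longrightarrow> nearby_element p \<in> carrier G"
  by (erule realisation_cases) (use members_carrier edge_verts in blast)+

lemma nearby_element_exit:
  assumes "p \<in> realisation cone_graph"
  obtains u a where "(u, a) \<in> exits cone_graph p" "a \<le> 1" "u \<in> verts cone_graph" "nearby_element p \<in> members u"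
  using assms
proof (cases rule: realisation_cases)
  case (Vertex v)
  then show ?thesis using that[of v 0] by simp
next
  case (Inner e t)
  have "len cone_graph e \<le> 1" using Inner(1) by (cases rule: edge_cases) auto
  then show ?thesis
    using that[of "tgt cone_graph e" "len cone_graph e - t"] Inner edge_verts(2)[OF Inner(1)] by simp
qed

lemma exit_near_nearby_element:
  assumes "p \<in> realisation cone_graph" "(u, a) \<in> exits cone_graph p"
  shows "u \<in> verts cone_graph" "0 \<le> a" "g \<in> members u \<Longrightarrow> cone_dist (nearby_element p) g \<le> 1"
proof -
  have "u \<in> verts cone_graph \<and> 0 \<le> a \<and> (g \<in> members u \<longrightarrow> cone_dist (nearby_element p) g \<le> 1)"
    using assms(1)
  proof (cases rule: realisation_cases)
    case (Vertex v)
    then show ?thesis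
      using assms(2) members_close[of v "nearby_element p" g] slack_bounds(2)[of v] by auto
  next
    case (Inner e t)
    have "cone_dist (nearby_element p) g \<le> 1" if "g \<in> members (tgt cone_graph e)"
      using members_close[OF edge_verts(2)[OF Inner(1)] Inner(5) that]
        slack_bounds(2)[of "tgt cone_graph e"] by linarith
    moreover have "cone_dist (nearby_element p) g \<le> 1" if "g \<in> members (src cone_graph e)"
      using edge_close[OF Inner(1) that Inner(5)] hops_commute[of "nearby_element p" g]
        members_carrier[OF edge_verts(1)[OF Inner(1)] that]
        members_carrier[OF edge_verts(2)[OF Inner(1)] Inner(5)] by simp
    ultimately show ?thesis using assms(2) Inner edge_verts[OF Inner(1)] by auto
  qed
  then show "u \<in> verts cone_graph" "0 \<le> a" "g \<in> members u \<Longrightarrow> cone_dist (nearby_element p) g \<le> 1" by auto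
qed

lemma cone_dist_le_route:
  assumes "route cone_graph p r q" and p: "p \<in> realisation cone_graph" and q: "q \<in> realisation cone_graph"
  shows "real (cone_dist (nearby_element p) (nearby_element q)) \<le> r + 3"
  using assms(1)
proof (cases rule: route.cases)
  case (within_edge e s t)
  then show ?thesis by simp
next
  case (via_vertices u a v b L)
  have u: "u \<in> verts cone_graph" "0 \<le> a" and v: "v \<in> verts cone_graph" "0 \<le> b"
    using exit_near_nearby_element p q via_vertices by blast+
  obtain g h where g: "g \<in> members u" and h: "h \<in> members v"
    using members_nonempty u(1) v(1) by blast
  have carr: "g \<in> carrier G" "h \<in> carrier G" using members_carrier u v g h by blast+
  have "cone_dist (nearby_element p) g \<le> 1" "cone_dist (nearby_element q) h \<le> 1"
    using exit_near_nearby_element(3) p q via_vertices g h by blast+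
  moreover have "real (cone_dist g h) \<le> L + slack u + slack v"
    using cone_dist_le_walk[OF via_vertices(4) h v(1) g] .
  moreover have "cone_dist (nearby_element p) (nearby_element q) \<le>
      cone_dist (nearby_element p) g + cone_dist g (nearby_element q)"
    "cone_dist g (nearby_element q) \<le> cone_dist g h + cone_dist h (nearby_element q)"
    using hops_triangle nearby_element_carrier p q carr by blast+
  moreover have "cone_dist h (nearby_element q) = cone_dist (nearby_element q) h"
    using hops_commute nearby_element_carrier q carr by blast
  ultimately show ?thesis
    using via_vertices(1) u(2) v(2) slack_bounds[of u] slack_bounds[of v] by linarith
qed

lemma route_near_cone_dist:
  assumes p: "p \<in> realisation cone_graph" and q: "q \<in> realisation cone_graph"
  obtains r where "route cone_graph p r q" "r \<le> real (cone_dist (nearby_element p) (nearby_element q)) + 3"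
proof -
  obtain u a where u: "(u, a) \<in> exits cone_graph p" "a \<le> 1" "u \<in> verts cone_graph" "nearby_element p \<in> members u"
    using nearby_element_exit[OF p] .
  obtain v b where v: "(v, b) \<in> exits cone_graph q" "b \<le> 1" "v \<in> verts cone_graph" "nearby_element q \<in> members v"
    using nearby_element_exit[OF q] .
  have "walk cone_graph u (slack u + (real (cone_dist (nearby_element p) (nearby_element q)) + slack v)) v"
    using walk_append[OF walk_member(1)[OF u(3,4)] walk_append[OF cone_dist_walk walk_member(2)[OF v(3,4)]]]
      nearby_element_carrier p q by blast
  then show thesis
    using that[OF via_vertices[OF u(1) v(1)]] u(2) v(2) slack_bounds[of u] slack_bounds[of v] by simp
qed

text \<open>The constant consists of at most \<open>1\<close> for moving from a point to its nearby element, at either end, and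
  of at most \<open>1/2\<close> for the slack, again at either end.\<close>

lemma gdist_near_cone_dist:
  assumes p: "p \<in> realisation cone_graph" and q: "q \<in> realisation cone_graph"
  shows "\<bar>gdist cone_graph p q - real (cone_dist (nearby_element p) (nearby_element q))\<bar> \<le> 3"
proof -
  define N where "N = real (cone_dist (nearby_element p) (nearby_element q))"
  have lower: "N - 3 \<le> r" if "r \<in> {r. route cone_graph p r q}" for r
    using cone_dist_le_route[OF _ p q, of r] that by (simp add: N_def)
  obtain r where r: "route cone_graph p r q" "r \<le> N + 3"
    using route_near_cone_dist[OF p q] unfolding N_def by blast
  have "gdist cone_graph p q \<le> r"
    unfolding gdist_def using r(1) lower by (intro cInf_lower) (auto simp: bdd_below_def)
  moreover have "N - 3 \<le> gdist cone_graph p q"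
    unfolding gdist_def using r(1) lower by (intro cInf_greatest) auto
  ultimately show ?thesis using r(2) unfolding N_def[symmetric] by linarith
qed

end

section \<open>Sets that are bounded in the coned-off word metric\<close>

context coned_off
begin

text \<open>Boundedness of \<open>T\<close> in the coned-off word metric, in the form that is convenient for products: right
  multiplication by elements of \<open>T\<close> moves every \<open>g\<close> by a bounded amount.\<close>

definition cone_bounded :: "'a set \<Rightarrow> bool" where
  "cone_bounded T \<longleftrightarrow> T \<subseteq> carrier G \<and> (\<exists>B. \<forall>g\<in>carrier G. \<forall>t\<in>T. cone_dist g (g \<otimes> t) \<le> B)"

lemma cone_bounded_subset: "cone_bounded T \<Longrightarrow> T' \<subseteq> T \<Longrightarrow> cone_bounded T'"
  unfolding cone_bounded_def by blast

text \<open>The word metric is invariant under left multiplication.\<close>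

lemma cone_bounded_singleton:
  assumes "t \<in> carrier G"
  shows "cone_bounded {t}"
proof -
  have "cone_dist g (g \<otimes> t) \<le> cone_dist \<one> t" if g: "g \<in> carrier G" for g
  proof (rule hops_le)
    have "(cone_step ^^ n) (g \<otimes> a) (g \<otimes> b)" if "(cone_step ^^ n) a b" for n a b
      using that
    proof (induction n arbitrary: b)
      case (Suc n)
      then obtain c where c: "(cone_step ^^ n) a c" "cone_step c b" by auto
      have "inv (g \<otimes> c) \<otimes> (g \<otimes> b) = inv c \<otimes> b"
        using c(2) g by (simp add: cone_step_def inv_mult_group m_assoc) (simp add: m_assoc[symmetric])
      then have "cone_step (g \<otimes> c) (g \<otimes> b)" using c(2) g by (simp add: cone_step_def)
      then show ?case using Suc.IH[OF c(1)] by auto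
    qed simp
    from this[OF hops_attained[OF one_closed assms]]
    show "(cone_step ^^ cone_dist \<one> t) g (g \<otimes> t)" using g by simp
  qed
  then show ?thesis using assms unfolding cone_bounded_def by auto
qed

lemma cone_bounded_set_mult:
  assumes "cone_bounded T" "cone_bounded T'"
  shows "cone_bounded (T <#> T')"
proof -
  obtain B B' where B: "\<And>g t. g \<in> carrier G \<Longrightarrow> t \<in> T \<Longrightarrow> cone_dist g (g \<otimes> t) \<le> B"
    and B': "\<And>g t. g \<in> carrier G \<Longrightarrow> t \<in> T' \<Longrightarrow> cone_dist g (g \<otimes> t) \<le> B'"
    and sub: "T \<subseteq> carrier G" "T' \<subseteq> carrier G"
    using assms unfolding cone_bounded_def by blast
  have "cone_dist g (g \<otimes> (t \<otimes> t')) \<le> B + B'" if "g \<in> carrier G" "t \<in> T" "t' \<in> T'" for g t t'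
  proof -
    have carr: "t \<in> carrier G" "t' \<in> carrier G" using that sub by auto
    have "cone_dist g (g \<otimes> (t \<otimes> t')) \<le> cone_dist g (g \<otimes> t) + cone_dist (g \<otimes> t) (g \<otimes> (t \<otimes> t'))"
      using that(1) carr by (intro hops_triangle) auto
    moreover have "cone_dist (g \<otimes> t) (g \<otimes> (t \<otimes> t')) \<le> B'"
      using B'[of "g \<otimes> t" t'] that carr by (simp add: m_assoc)
    ultimately show ?thesis using B[OF that(1,2)] by linarith
  qed
  then show ?thesis
    using sub unfolding cone_bounded_def set_mult_def by (auto intro!: exI[of _ "B + B'"])
qed

lemma cone_bounded_inv:
  assumes "cone_bounded T"
  shows "cone_bounded (m_inv G ` T)"
proof -
  obtain B where B: "\<And>g t. g \<in> carrier G \<Longrightarrow> t \<in> T \<Longrightarrow> cone_dist g (g \<otimes> t) \<le> B"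
    and sub: "T \<subseteq> carrier G"
    using assms unfolding cone_bounded_def by blast
  have "cone_dist g (g \<otimes> inv t) \<le> B" if "g \<in> carrier G" "t \<in> T" for g t
  proof -
    have t: "t \<in> carrier G" using that sub by auto
    have "cone_dist (g \<otimes> inv t) g \<le> B"
      using B[of "g \<otimes> inv t" t] that t by (simp add: m_assoc)
    then show ?thesis using hops_commute[of g "g \<otimes> inv t"] that t by simp
  qed
  then show ?thesis using sub unfolding cone_bounded_def by auto
qed

lemma cone_bounded_Un:
  assumes "cone_bounded T" "cone_bounded T'"
  shows "cone_bounded (T \<union> T')"
proof -
  obtain B B' where B: "\<forall>g\<in>carrier G. \<forall>t\<in>T. cone_dist g (g \<otimes> t) \<le> B"
    and B': "\<forall>g\<in>carrier G. \<forall>t\<in>T'. cone_dist g (g \<otimes> t) \<le> B'"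
    using assms unfolding cone_bounded_def by blast
  have "\<forall>g\<in>carrier G. \<forall>t\<in>T \<union> T'. cone_dist g (g \<otimes> t) \<le> max B B'"
    using B B' by (auto simp: le_max_iff_disj)
  then show ?thesis using assms unfolding cone_bounded_def by blast
qed

lemma cone_bounded_UN:
  assumes "finite I" "\<And>i. i \<in> I \<Longrightarrow> cone_bounded (T i)"
  shows "cone_bounded (\<Union>i\<in>I. T i)"
  using assms
proof (induction I)
  case empty
  then show ?case by (simp add: cone_bounded_def)
qed (simp add: cone_bounded_Un)

lemma cone_bounded_cone_subgroup:
  assumes "H \<in> \<H>"
  shows "cone_bounded H"
proof -
  have "H \<subseteq> cone_generators" using assms unfolding cone_generators_def by blast
  then have "cone_dist g (g \<otimes> t) \<le> 1" if "g \<in> carrier G" "t \<in> H" for g t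
    using that by (intro cone_step_hops cone_stepI) auto
  then show ?thesis using subgroup.subset[OF \<H>[OF assms]] unfolding cone_bounded_def by blast
qed

end

section \<open>Discontinuous co-compact actions\<close>

locale discontinuous_isometric_action = group_action G UNIV \<phi>
  for G (structure) and \<phi> :: "'g \<Rightarrow> 'x::metric_space \<Rightarrow> 'x" +
  assumes isometry: "\<And>g x y. g \<in> carrier G \<Longrightarrow> dist (\<phi> g x) (\<phi> g y) = dist x y"
    and discrete_orbits: "\<And>x. discrete (orbit G \<phi> x)"

sublocale discontinuous_isometric_action \<subseteq> group G
  using group_hom by (simp add: group_hom_def)

context discontinuous_isometric_action
begin

lemma act_mult: "g \<in> carrier G \<Longrightarrow> h \<in> carrier G \<Longrightarrow> \<phi> (g \<otimes> h) x = \<phi> g (\<phi> h x)"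
  using composition_rule by simp

lemma act_one [simp]: "\<phi> \<one> x = x"
  using fun_cong[OF id_eq_one, of x] by simp

lemma act_inv:
  assumes "g \<in> carrier G"
  shows "\<phi> (inv g) (\<phi> g x) = x" "\<phi> g (\<phi> (inv g) x) = x"
  using act_mult[of "inv g" g x] act_mult[of g "inv g" x] assms by simp_all

lemma dist_act: 
  assumes "g \<in> carrier G" "h \<in> carrier G"
  shows "dist (\<phi> g x) (\<phi> h y) = dist x (\<phi> (inv g \<otimes> h) y)"
proof -
  have "\<phi> g (\<phi> (inv g \<otimes> h) y) = \<phi> h y" using assms by (simp add: act_mult act_inv)
  then show ?thesis using isometry[OF assms(1), of x "\<phi> (inv g \<otimes> h) y"] by simp
qed

text \<open>The factor \<open>3\<close> leaves room for two balls of radius at most \<open>r\<close> whose distance is less than \<open>r\<close>.\<close>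

definition separating_radius :: "'x \<Rightarrow> real \<Rightarrow> bool" where
  "separating_radius x r \<longleftrightarrow> 0 < r \<and> (\<forall>g\<in>carrier G. \<forall>h\<in>carrier G. \<forall>z.
     dist z (\<phi> g x) < 3 * r \<and> dist z (\<phi> h x) < 3 * r \<longrightarrow> \<phi> g x = \<phi> h x)"

lemma separating_radiusD:
  assumes "separating_radius x r" "g \<in> carrier G" "h \<in> carrier G"
    "dist z (\<phi> g x) < 3 * r" "dist z (\<phi> h x) < 3 * r"
  shows "\<phi> g x = \<phi> h x"
  using assms unfolding separating_radius_def by blast

lemma separating_radius_exists: "\<exists>r. separating_radius x r"
proof -
  have "\<phi> \<one> x \<in> orbit G \<phi> x" unfolding orbit_def by blast
  then have "x isolated_in orbit G \<phi> x" using discreteD[OF discrete_orbits] by simp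
  then obtain e where e: "e > 0" "\<And>y. y \<in> orbit G \<phi> x \<Longrightarrow> dist x y < e \<Longrightarrow> y = x"
    unfolding isolated_in_dist_Ex_iff by blast
  have "\<phi> g x = \<phi> h x"
    if "g \<in> carrier G" "h \<in> carrier G" "dist z (\<phi> g x) < 3 * (e / 6)" "dist z (\<phi> h x) < 3 * (e / 6)" for g h z
  proof -
    have "dist x (\<phi> (inv g \<otimes> h) x) < e"
      using dist_triangle3[of "\<phi> g x" "\<phi> h x" z] that by (simp add: dist_act)
    moreover have "\<phi> (inv g \<otimes> h) x \<in> orbit G \<phi> x" using that unfolding orbit_def by blast
    ultimately have "\<phi> (inv g \<otimes> h) x = x" using e(2) by blast
    then have "\<phi> g (\<phi> (inv g \<otimes> h) x) = \<phi> g x" by simp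
    then show ?thesis using that by (simp add: act_mult act_inv)
  qed
  then have "separating_radius x (e / 6)" using e(1) unfolding separating_radius_def
    by (intro conjI) (simp, blast)
  then show ?thesis ..
qed

text \<open>An element that fixes \<open>z\<close> does not change the distance to \<open>z\<close>, so it moves \<open>\<phi> g p\<close> to another nearby
  translate of \<open>p\<close>, and there is only one.\<close>

lemma stabilizer_of_near_point:
  assumes "separating_radius p r" "g \<in> carrier G" "dist z (\<phi> g p) < 3 * r"
  shows "stabilizer G \<phi> z \<subseteq> stabilizer G \<phi> (\<phi> g p)"
proof
  fix s assume "s \<in> stabilizer G \<phi> z"
  then have s: "s \<in> carrier G" "\<phi> s z = z" by (auto simp: stabilizer_def)
  have "dist z (\<phi> (s \<otimes> g) p) = dist z (\<phi> g p)"
    using isometry[OF s(1), of z "\<phi> g p"] s assms(2) by (simp add: act_mult)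
  then have "\<phi> (s \<otimes> g) p = \<phi> g p"
    using separating_radiusD[OF assms(1)] s(1) assms(2,3) by (metis m_closed)
  then show "s \<in> stabilizer G \<phi> (\<phi> g p)" using s assms(2) by (simp add: stabilizer_def act_mult)
qed

lemma stabilizer_isotropy: "isotropy_subgroup G \<phi> (stabilizer G \<phi> x)"
  using stabilizer_subgroup[of x] unfolding isotropy_subgroup_def stabilizer_def by auto

lemma conjugate_stabilizers:
  assumes a: "a \<in> carrier G"
  shows "conjugate_subgroups G (stabilizer G \<phi> x) (stabilizer G \<phi> (\<phi> a x))"
  unfolding conjugate_subgroups_def
proof (intro bexI[OF _ a] subset_antisym subsetI)
  fix s assume "s \<in> stabilizer G \<phi> (\<phi> a x)"
  then have s: "s \<in> carrier G" "\<phi> s (\<phi> a x) = \<phi> a x" by (auto simp: stabilizer_def)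
  define t where "t = inv a \<otimes> s \<otimes> a"
  have "t \<in> stabilizer G \<phi> x" using s a by (simp add: t_def stabilizer_def act_mult act_inv)
  then have "a \<otimes> t \<in> a <# stabilizer G \<phi> x" unfolding l_coset_def by blast
  moreover have "s = (a \<otimes> t) \<otimes> inv a"
    using s(1) a by (simp add: t_def m_assoc) (simp add: m_assoc[symmetric])
  ultimately show "s \<in> (a <# stabilizer G \<phi> x) #> inv a" unfolding r_coset_def by blast
next
  fix s assume "s \<in> (a <# stabilizer G \<phi> x) #> inv a"
  then obtain t where "t \<in> stabilizer G \<phi> x" "s = (a \<otimes> t) \<otimes> inv a"
    unfolding l_coset_def r_coset_def by blast
  then show "s \<in> stabilizer G \<phi> (\<phi> a x)" using a by (simp add: stabilizer_def act_mult act_inv)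
qed

definition separated_cover :: "'x set \<Rightarrow> ('x \<Rightarrow> real) \<Rightarrow> bool" where
  "separated_cover P r \<longleftrightarrow> finite P \<and> P \<noteq> {} \<and> (\<forall>p\<in>P. separating_radius p (r p)) \<and>
     (\<forall>z. \<exists>g\<in>carrier G. \<exists>p\<in>P. dist z (\<phi> g p) < r p)"

lemma separated_coverD:
  assumes "separated_cover P r"
  shows "finite P" "P \<noteq> {}" "p \<in> P \<Longrightarrow> separating_radius p (r p)" "p \<in> P \<Longrightarrow> 0 < r p"
    "\<exists>g\<in>carrier G. \<exists>p\<in>P. dist z (\<phi> g p) < r p"
  using assms by (auto simp: separated_cover_def separating_radius_def)

lemma separated_cover_exists:
  assumes "cocompact_action G \<phi>"
  shows "\<exists>P r. separated_cover P r"
proof -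
  obtain K where K: "compact K" "(\<Union>g\<in>carrier G. \<phi> g ` K) = UNIV"
    using assms unfolding cocompact_action_def by blast
  obtain r where r: "\<And>x. separating_radius x (r x)" using separating_radius_exists by metis
  have "K \<subseteq> (\<Union>x\<in>K. ball x (r x))" using r by (force simp: separating_radius_def)
  then obtain P where P: "P \<subseteq> K" "finite P" "K \<subseteq> (\<Union>x\<in>P. ball x (r x))"
    using compactE_image[OF K(1), of K "\<lambda>x. ball x (r x)"] by blast
  have cover: "\<exists>g\<in>carrier G. \<exists>p\<in>P. dist z (\<phi> g p) < r p" for z
  proof -
    have "z \<in> (\<Union>g\<in>carrier G. \<phi> g ` K)" using K(2) by simp
    then obtain g k where g: "g \<in> carrier G" "k \<in> K" "z = \<phi> g k" by blast
    then obtain p where "p \<in> P" "dist p k < r p" using P(3) by force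
    then have "dist z (\<phi> g p) < r p" using g isometry[OF g(1), of k p] by (simp add: dist_commute)
    then show ?thesis using g(1) \<open>p \<in> P\<close> by blast
  qed
  then have "P \<noteq> {}" by blast
  then have "separated_cover P r" using P(2) r cover by (simp add: separated_cover_def)
  then show ?thesis by blast
qed

lemma maximal_isotropy_eq_stabilizer:
  assumes cover: "separated_cover P r"
    and H: "maximal_isotropy_subgroup G \<phi> H"
  obtains g p where "g \<in> carrier G" "p \<in> P" "H = stabilizer G \<phi> (\<phi> g p)"
proof -
  obtain z where z: "\<forall>h\<in>H. \<phi> h z = z"
    using H unfolding maximal_isotropy_subgroup_def isotropy_subgroup_def by blast
  obtain g p where g: "g \<in> carrier G" "p \<in> P" "dist z (\<phi> g p) < r p"
    using separated_coverD(5)[OF cover] by blast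
  have "stabilizer G \<phi> z \<subseteq> stabilizer G \<phi> (\<phi> g p)"
    using stabilizer_of_near_point[OF separated_coverD(3)[OF cover g(2)] g(1)] g(3)
      separated_coverD(4)[OF cover g(2)] by simp
  moreover have "H \<subseteq> stabilizer G \<phi> z"
  proof -
    have "subgroup H G" using H by (simp add: maximal_isotropy_subgroup_def isotropy_subgroup_def)
    then show ?thesis using z by (auto simp: stabilizer_def dest: subgroup.mem_carrier)
  qed
  ultimately have "H = stabilizer G \<phi> (\<phi> g p)"
    using H stabilizer_isotropy unfolding maximal_isotropy_subgroup_def by blast
  then show thesis using that g by blast
qed

text \<open>Two representatives that belong to the same ball of the finite cover are conjugate to the stabiliser of
  its centre, hence to each other, hence equal.\<close>

lemma finite_maximal_isotropy_representatives:
  assumes "cocompact_action G \<phi>" and reps: "maximal_isotropy_representatives G \<phi> \<H>"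
  shows "finite \<H>"
proof -
  obtain P r where cover: "separated_cover P r" using separated_cover_exists[OF assms(1)] by blast
  have max: "maximal_isotropy_subgroup G \<phi> H" if "H \<in> \<H>" for H
    using reps that unfolding maximal_isotropy_representatives_def by blast
  have "\<exists>p\<in>P. \<exists>g\<in>carrier G. H = stabilizer G \<phi> (\<phi> g p)" if H: "H \<in> \<H>" for H
    using maximal_isotropy_eq_stabilizer[OF cover max[OF H]] by metis
  then obtain c where c: "\<And>H. H \<in> \<H> \<Longrightarrow> c H \<in> P"
    and stab: "\<And>H. H \<in> \<H> \<Longrightarrow> \<exists>g\<in>carrier G. H = stabilizer G \<phi> (\<phi> g (c H))"
    by metis
  have "inj_on c \<H>"
  proof (rule inj_onI)
    fix H H' assume H: "H \<in> \<H>" "H' \<in> \<H>" "c H = c H'"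
    define p where "p = c H"
    obtain g where g: "g \<in> carrier G" "H = stabilizer G \<phi> (\<phi> g p)"
      using stab[OF H(1)] unfolding p_def by blast
    obtain g' where g': "g' \<in> carrier G" "H' = stabilizer G \<phi> (\<phi> g' p)"
      using stab[OF H(2)] H(3) unfolding p_def by metis
    have "\<phi> (g' \<otimes> inv g) (\<phi> g p) = \<phi> g' p" using g(1) g'(1) by (simp add: act_mult act_inv)
    then have "conjugate_subgroups G H H'"
      using conjugate_stabilizers[of "g' \<otimes> inv g" "\<phi> g p"] g g' by simp
    moreover have "conjugate_subgroups G H' H'"
      using conjugate_stabilizers[of \<one> "\<phi> g' p"] g' by simp
    ultimately show "H = H'"
      using reps max[OF H(2)] H(1,2) unfolding maximal_isotropy_representatives_def by blast
  qed
  moreover have "c ` \<H> \<subseteq> P" using c by blast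
  ultimately show ?thesis using separated_coverD(1)[OF cover] finite_imageD finite_subset by blast
qed

end

section \<open>The orbit map is a quasi-isometry\<close>

text \<open>A nearly shortest path allows one to advance by \<open>\<delta> / 2\<close> while the remaining distance decreases by
  at least \<open>\<delta> / 4\<close>; each such step costs at most \<open>B\<close>.\<close>

lemma length_space_coarsely_lipschitz:
  fixes D :: "'x::metric_space \<Rightarrow> 'x \<Rightarrow> real"
  assumes len: "length_space TYPE('x)" and "0 < \<delta>" "0 \<le> B"
    and triangle: "\<And>x y z. D x z \<le> D x y + D y z"
    and local: "\<And>x y. dist x y < \<delta> \<Longrightarrow> D x y \<le> B"
  shows "D x y \<le> (4 * B / \<delta>) * dist x y + 2 * B"
proof -
  have *: "D x y \<le> B * (real n + 1)" if "dist x y \<le> real n * (\<delta> / 4)" for n x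
    using that
  proof (induction n arbitrary: x)
    case 0
    then show ?case using local[of x y] \<open>0 < \<delta>\<close> by simp
  next
    case (Suc n)
    show ?case
    proof (cases "dist x y < \<delta>")
      case True
      have "B \<le> B * (real (Suc n) + 1)" using \<open>0 \<le> B\<close> by (simp add: mult_le_cancel_left1)
      then show ?thesis using local[OF True] by linarith
    next
      case False
      obtain \<gamma> where \<gamma>: "path \<gamma>" "\<gamma> 0 = x" "\<gamma> 1 = y"
        and geo: "\<And>s t u. 0 \<le> s \<Longrightarrow> s \<le> t \<Longrightarrow> t \<le> u \<Longrightarrow> u \<le> 1 \<Longrightarrow>
          dist (\<gamma> s) (\<gamma> t) + dist (\<gamma> t) (\<gamma> u) \<le> dist (\<gamma> s) (\<gamma> u) + \<delta> / 4"
        using near_geodesic_exists[OF len, of "\<delta> / 4" x y] \<open>0 < \<delta>\<close> by auto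
      obtain s where s: "s \<in> closed_segment 0 1" "dist (\<gamma> 0) (\<gamma> s) = \<delta> / 2"
        using path_dist_attained[OF \<gamma>(1), of 0 1 "\<delta> / 2"] False \<gamma> \<open>0 < \<delta>\<close> by auto
      have "dist (\<gamma> s) y \<le> real n * (\<delta> / 4)"
        using geo[of 0 s 1] s \<gamma> Suc.prems
        by (auto simp: closed_segment_eq_real_ivl algebra_simps)
      then have "D (\<gamma> s) y \<le> B * (real n + 1)" by (rule Suc.IH)
      moreover have "D x (\<gamma> s) \<le> B" using s \<gamma> \<open>0 < \<delta>\<close> by (intro local) auto
      ultimately show ?thesis using triangle[of x y "\<gamma> s"] by (simp add: algebra_simps)
    qed
  qed
  define n where "n = nat \<lceil>4 * dist x y / \<delta>\<rceil>"
  have "4 * dist x y / \<delta> \<le> real n" unfolding n_def by linarith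
  then have "dist x y \<le> real n * (\<delta> / 4)" using \<open>0 < \<delta>\<close> by (simp add: field_simps)
  then have "D x y \<le> B * (real n + 1)" by (rule *)
  moreover have "0 \<le> 4 * dist x y / \<delta>" using \<open>0 < \<delta>\<close> by simp
  then have "real n \<le> 4 * dist x y / \<delta> + 1" unfolding n_def by linarith
  then have "B * (real n + 1) \<le> B * (4 * dist x y / \<delta> + 2)" using \<open>0 \<le> B\<close> by (intro mult_left_mono) auto
  ultimately show ?thesis by (simp add: algebra_simps)
qed

locale coned_off_action = coned_off G S \<H> + discontinuous_isometric_action G \<phi>
  for G :: "('g, 'm) monoid_scheme" (structure) and S \<H> and \<phi> :: "'g \<Rightarrow> 'x::metric_space \<Rightarrow> 'x" +
  assumes finite_generators: "finite S"
    and length: "length_space TYPE('x)"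
    and cocompact: "cocompact_action G \<phi>"
    and reps: "maximal_isotropy_representatives G \<phi> \<H>"
    and below: "isotropy_subgroups_below_maximal G \<phi>"
begin

lemma cone_bounded_stabilizer: "cone_bounded (stabilizer G \<phi> x)"
proof -
  obtain M where M: "maximal_isotropy_subgroup G \<phi> M" "stabilizer G \<phi> x \<subseteq> M"
    using below stabilizer_isotropy unfolding isotropy_subgroups_below_maximal_def by blast
  obtain H where H: "H \<in> \<H>" "conjugate_subgroups G H M"
    using reps M(1) unfolding maximal_isotropy_representatives_def by blast
  obtain a where a: "a \<in> carrier G" "M = (a <# H) #> inv a"
    using H(2) unfolding conjugate_subgroups_def by blast
  have "cone_bounded (({a} <#> H) <#> {inv a})"
    using a(1) H(1) by (intro cone_bounded_set_mult cone_bounded_singleton cone_bounded_cone_subgroup) auto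
  moreover have "M = ({a} <#> H) <#> {inv a}"
    unfolding a(2) by (auto simp: l_coset_def r_coset_def set_mult_def)
  ultimately show ?thesis using cone_bounded_subset M(2) by blast
qed

text \<open>All these \<open>t\<close> map \<open>q\<close> to the same point, so they form a part of a single left coset of the stabiliser of
  \<open>q\<close>.\<close>

lemma cone_bounded_translates_near:
  assumes "separating_radius q r"
  shows "cone_bounded {t \<in> carrier G. dist p (\<phi> t q) < 3 * r}"
proof (cases "{t \<in> carrier G. dist p (\<phi> t q) < 3 * r} = {}")
  case True
  show ?thesis unfolding True by (simp add: cone_bounded_def)
next
  case False
  then obtain t0 where t0: "t0 \<in> carrier G" "dist p (\<phi> t0 q) < 3 * r" by blast
  have "t \<in> {t0} <#> stabilizer G \<phi> q" if t: "t \<in> carrier G" "dist p (\<phi> t q) < 3 * r" for t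
  proof -
    have "\<phi> t q = \<phi> t0 q" using separating_radiusD[OF assms] t t0 by blast
    then have "inv t0 \<otimes> t \<in> stabilizer G \<phi> q"
      using t(1) t0(1) by (simp add: stabilizer_def act_mult act_inv)
    moreover have "t = t0 \<otimes> (inv t0 \<otimes> t)" using t(1) t0(1) by (simp add: m_assoc[symmetric])
    ultimately show ?thesis unfolding set_mult_def by blast
  qed
  moreover have "cone_bounded ({t0} <#> stabilizer G \<phi> q)"
    using t0(1) by (intro cone_bounded_set_mult cone_bounded_singleton cone_bounded_stabilizer)
  ultimately show ?thesis by (elim cone_bounded_subset) blast
qed

text \<open>The preceding lemma is applied to the ball of larger radius. When this is the first one, the roles of
  \<open>g\<close> and \<open>h\<close> are exchanged, which inverts the connecting element \<open>inv g \<otimes> h\<close>.\<close>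

lemma cone_dist_bounded_if_balls_near:
  assumes cover: "separated_cover P r"
  obtains B where "\<And>g h p q. g \<in> carrier G \<Longrightarrow> h \<in> carrier G \<Longrightarrow> p \<in> P \<Longrightarrow> q \<in> P \<Longrightarrow>
    dist (\<phi> g p) (\<phi> h q) < 3 * max (r p) (r q) \<Longrightarrow> cone_dist g h \<le> B"
proof -
  define N where "N p q = {t \<in> carrier G. dist p (\<phi> t q) < 3 * r q}" for p q
  have N: "cone_bounded (N p q)" if "q \<in> P" for p q
    unfolding N_def by (intro cone_bounded_translates_near separated_coverD(3)[OF cover] that)
  define U where "U = (\<Union>p\<in>P. \<Union>q\<in>P. N p q \<union> m_inv G ` N q p)"
  have "cone_bounded U"
    unfolding U_def using separated_coverD(1)[OF cover] N
    by (intro cone_bounded_UN cone_bounded_Un cone_bounded_inv) auto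
  then obtain B where B: "\<forall>g\<in>carrier G. \<forall>t\<in>U. cone_dist g (g \<otimes> t) \<le> B"
    unfolding cone_bounded_def by blast
  show thesis
  proof (rule that)
    fix g h p q assume g: "g \<in> carrier G" "h \<in> carrier G" and pq: "p \<in> P" "q \<in> P"
      and near: "dist (\<phi> g p) (\<phi> h q) < 3 * max (r p) (r q)"
    define t where "t = inv g \<otimes> h"
    have t: "t \<in> carrier G" "inv t = inv h \<otimes> g" "g \<otimes> t = h"
      using g by (simp_all add: t_def inv_mult_group) (simp add: m_assoc[symmetric])
    have "t \<in> N p q \<or> inv t \<in> N q p"
    proof (cases "r p \<le> r q")
      case True
      then show ?thesis using near t(1) dist_act[OF g, of p q] by (simp add: N_def t_def)
    next
      case False
      then show ?thesis using near g t(1,2) dist_act[OF g(2,1), of q p] by (simp add: N_def dist_commute)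
    qed
    moreover have "t = inv (inv t)" using t(1) by simp
    ultimately have "t \<in> U" unfolding U_def using pq by blast
    then show "cone_dist g h \<le> B" using B g(1) t(3) by force
  qed
qed

text \<open>Every point \<open>z\<close> is labelled by an element \<open>l z\<close> for which \<open>z\<close> lies in a ball \<open>l z B(c z, r (c z))\<close>.
  Labels of points at distance less than the smallest radius \<open>\<delta>\<close> are at bounded distance, so \<open>l\<close> is
  coarsely Lipschitz, and \<open>l\<close> is a coarse inverse of the orbit map.\<close>

lemma cone_dist_coarsely_lipschitz:
  assumes cover: "separated_cover P r" and x0: "x0 \<in> P"
  obtains A where "0 \<le> A" "\<And>g h. g \<in> carrier G \<Longrightarrow> h \<in> carrier G \<Longrightarrow>
    real (cone_dist g h) \<le> A * dist (\<phi> g x0) (\<phi> h x0) + A"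
proof -
  obtain B where B: "\<And>g h p q. g \<in> carrier G \<Longrightarrow> h \<in> carrier G \<Longrightarrow> p \<in> P \<Longrightarrow> q \<in> P \<Longrightarrow>
    dist (\<phi> g p) (\<phi> h q) < 3 * max (r p) (r q) \<Longrightarrow> cone_dist g h \<le> B"
    using cone_dist_bounded_if_balls_near[OF cover] by blast
  obtain l c where l: "\<And>z. l z \<in> carrier G" and c: "\<And>z. c z \<in> P" and lc: "\<And>z. dist z (\<phi> (l z) (c z)) < r (c z)"
    using separated_coverD(5)[OF cover] by metis
  note r_pos = separated_coverD(4)[OF cover]
  define \<delta> where "\<delta> = Min (r ` P)"
  have \<delta>: "0 < \<delta>" "\<And>p. p \<in> P \<Longrightarrow> \<delta> \<le> r p"
    using separated_coverD(1,2)[OF cover] r_pos by (auto simp: \<delta>_def Min_gr_iff)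
  have local: "real (cone_dist (l x) (l y)) \<le> real B" if "dist x y < \<delta>" for x y
  proof -
    have "dist (\<phi> (l x) (c x)) (\<phi> (l y) (c y)) < r (c x) + \<delta> + r (c y)"
      using lc[of x] lc[of y] that dist_triangle3[of "\<phi> (l x) (c x)" "\<phi> (l y) (c y)" x]
        dist_triangle[of x "\<phi> (l y) (c y)" y] by linarith
    also have "\<dots> \<le> 3 * max (r (c x)) (r (c y))" using \<delta>(2)[OF c[of x]] by linarith
    finally show ?thesis using B[OF l l c c] by simp
  qed
  define A0 where "A0 = 4 * real B / \<delta>"
  have lip: "real (cone_dist (l x) (l y)) \<le> A0 * dist x y + 2 * real B" for x y
    unfolding A0_def
  proof (rule length_space_coarsely_lipschitz[OF length \<delta>(1) _ _ local])
    show "real (cone_dist (l x) (l z)) \<le> real (cone_dist (l x) (l y)) + real (cone_dist (l y) (l z))" for x y z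
      using hops_triangle[OF l l l, of x z y] by linarith
  qed auto
  have own: "cone_dist g (l (\<phi> g x0)) \<le> B" if "g \<in> carrier G" for g
  proof (rule B[OF that l x0 c])
    show "dist (\<phi> g x0) (\<phi> (l (\<phi> g x0)) (c (\<phi> g x0))) < 3 * max (r x0) (r (c (\<phi> g x0)))"
      using lc[of "\<phi> g x0"] r_pos[OF c[of "\<phi> g x0"]] by linarith
  qed
  have A0: "0 \<le> A0" using \<delta>(1) by (simp add: A0_def)
  show thesis
  proof (rule that[of "max A0 (4 * real B)"])
    fix g h assume g: "g \<in> carrier G" and h: "h \<in> carrier G"
    have "cone_dist g h \<le> cone_dist g (l (\<phi> g x0)) +
        (cone_dist (l (\<phi> g x0)) (l (\<phi> h x0)) + cone_dist (l (\<phi> h x0)) h)"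
      using hops_triangle[OF g l h, of "\<phi> g x0"] hops_triangle[OF l l h, of "\<phi> g x0" "\<phi> h x0"] by linarith
    moreover have "cone_dist (l (\<phi> h x0)) h \<le> B" using own[OF h] hops_commute[OF h l] by simp
    ultimately have "real (cone_dist g h) \<le> A0 * dist (\<phi> g x0) (\<phi> h x0) + 4 * real B"
      using own[OF g] lip[of "\<phi> g x0" "\<phi> h x0"] by linarith
    also have "\<dots> \<le> max A0 (4 * real B) * dist (\<phi> g x0) (\<phi> h x0) + max A0 (4 * real B)"
      by (intro add_mono mult_right_mono) auto
    finally show "real (cone_dist g h) \<le> max A0 (4 * real B) * dist (\<phi> g x0) (\<phi> h x0) + max A0 (4 * real B)" .
  qed (use A0 in simp)
qed

lemma orbit_map_lipschitz:
  obtains B where "0 \<le> B" "\<And>g h. g \<in> carrier G \<Longrightarrow> h \<in> carrier G \<Longrightarrow>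
    dist (\<phi> g x0) (\<phi> h x0) \<le> B * real (cone_dist g h)"
proof -
  have "\<exists>x. \<forall>h\<in>H. \<phi> h x = x" if "H \<in> \<H>" for H
    using reps that
    unfolding maximal_isotropy_representatives_def maximal_isotropy_subgroup_def isotropy_subgroup_def by blast
  then obtain c where c: "\<And>H h. H \<in> \<H> \<Longrightarrow> h \<in> H \<Longrightarrow> \<phi> h (c H) = c H" by metis
  have finH: "finite \<H>" using finite_maximal_isotropy_representatives[OF cocompact reps] .
  define b where "b = (\<Sum>s\<in>S. dist x0 (\<phi> s x0)) + (\<Sum>H\<in>\<H>. 2 * dist x0 (c H))"
  have b1: "dist x0 (\<phi> s x0) \<le> b" if "s \<in> S" for s
  proof -
    have "dist x0 (\<phi> s x0) \<le> (\<Sum>s\<in>S. dist x0 (\<phi> s x0))"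
      using that finite_generators by (intro member_le_sum) auto
    moreover have "0 \<le> (\<Sum>H\<in>\<H>. 2 * dist x0 (c H))" by (intro sum_nonneg) auto
    ultimately show ?thesis by (simp add: b_def)
  qed
  have b2: "2 * dist x0 (c H) \<le> b" if "H \<in> \<H>" for H
  proof -
    have "2 * dist x0 (c H) \<le> (\<Sum>H\<in>\<H>. 2 * dist x0 (c H))"
      using that finH by (intro member_le_sum) auto
    moreover have "0 \<le> (\<Sum>s\<in>S. dist x0 (\<phi> s x0))" by (intro sum_nonneg) auto
    ultimately show ?thesis by (simp add: b_def)
  qed
  have b0: "0 \<le> b" unfolding b_def by (intro add_nonneg_nonneg sum_nonneg) auto
  have gen: "dist x0 (\<phi> t x0) \<le> b" if t: "t \<in> cone_generators" for t
  proof -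
    from t consider "t \<in> S" | s where "s \<in> S" "t = inv s" | H where "H \<in> \<H>" "t \<in> H"
      unfolding cone_generators_def by blast
    then show ?thesis
    proof cases
      case 1
      then show ?thesis by (rule b1)
    next
      case 2
      then have s: "s \<in> carrier G" using S(1) by auto
      have "dist (\<phi> s x0) (\<phi> s (\<phi> t x0)) = dist x0 (\<phi> t x0)" by (rule isometry[OF s])
      then show ?thesis using b1[OF 2(1)] 2(2) s by (simp add: act_inv dist_commute)
    next
      case 3
      then have h: "t \<in> carrier G" using subgroup.mem_carrier[OF \<H>] by blast
      have "dist (\<phi> t x0) (c H) = dist x0 (c H)" using isometry[OF h, of x0 "c H"] c[OF 3] by simp
      then show ?thesis using dist_triangle2[of x0 "\<phi> t x0" "c H"] b2[OF 3(1)] by linarith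
    qed
  qed
  have step: "dist (\<phi> g x0) (\<phi> h x0) \<le> b" if "cone_step g h" for g h
    using that gen by (simp add: cone_step_def dist_act)
  have "dist (\<phi> g x0) (\<phi> h x0) \<le> b * real n" if "(cone_step ^^ n) g h" for n g h
    using that
  proof (induction n arbitrary: h)
    case (Suc n)
    then obtain k where k: "(cone_step ^^ n) g k" "cone_step k h" by auto
    show ?case
      using Suc.IH[OF k(1)] step[OF k(2)] dist_triangle[of "\<phi> g x0" "\<phi> h x0" "\<phi> k x0"]
      by (simp add: algebra_simps)
  qed simp
  then show thesis using that b0 hops_attained by blast
qed

lemma orbit_map_quasi_isometry:
  "\<exists>x0 K. 1 \<le> K \<and>
     (\<forall>g\<in>carrier G. \<forall>h\<in>carrier G.
        real (cone_dist g h) / K - K \<le> dist (\<phi> g x0) (\<phi> h x0) \<and>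
        dist (\<phi> g x0) (\<phi> h x0) \<le> K * real (cone_dist g h) + K) \<and>
     (\<forall>z. \<exists>g\<in>carrier G. dist z (\<phi> g x0) \<le> K)"
proof -
  obtain P r where cover: "separated_cover P r" using separated_cover_exists[OF cocompact] by blast
  obtain x0 where x0: "x0 \<in> P" using separated_coverD(2)[OF cover] by blast
  obtain A where A: "0 \<le> A" "\<And>g h. g \<in> carrier G \<Longrightarrow> h \<in> carrier G \<Longrightarrow>
    real (cone_dist g h) \<le> A * dist (\<phi> g x0) (\<phi> h x0) + A"
    using cone_dist_coarsely_lipschitz[OF cover x0] by blast
  obtain B where B: "0 \<le> B" "\<And>g h. g \<in> carrier G \<Longrightarrow> h \<in> carrier G \<Longrightarrow>
    dist (\<phi> g x0) (\<phi> h x0) \<le> B * real (cone_dist g h)"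
    using orbit_map_lipschitz by blast
  define E where "E = Max ((\<lambda>p. r p + dist p x0) ` P)"
  have E: "r p + dist p x0 \<le> E" if "p \<in> P" for p
    unfolding E_def using separated_coverD(1)[OF cover] that by (intro Max_ge) auto
  define K where "K = Max {1, A, B, E}"
  have K: "1 \<le> K" "A \<le> K" "B \<le> K" "E \<le> K" by (simp_all add: K_def)
  show ?thesis
  proof (intro exI[of _ x0] exI[of _ K] conjI ballI allI)
    fix g h assume gh: "g \<in> carrier G" "h \<in> carrier G"
    have "real (cone_dist g h) \<le> K * dist (\<phi> g x0) (\<phi> h x0) + K"
      using A(2)[OF gh] mult_right_mono[OF K(2), of "dist (\<phi> g x0) (\<phi> h x0)"] K(2) by simp
    then have "real (cone_dist g h) / K \<le> dist (\<phi> g x0) (\<phi> h x0) + 1" using K(1) by (simp add: field_simps)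
    then show "real (cone_dist g h) / K - K \<le> dist (\<phi> g x0) (\<phi> h x0)" using K(1) by linarith
    show "dist (\<phi> g x0) (\<phi> h x0) \<le> K * real (cone_dist g h) + K"
      using B(2)[OF gh] mult_right_mono[OF K(3), of "real (cone_dist g h)"] K(1) by simp
  next
    fix z
    obtain g p where g: "g \<in> carrier G" "p \<in> P" "dist z (\<phi> g p) < r p"
      using separated_coverD(5)[OF cover] by blast
    have "dist (\<phi> g p) (\<phi> g x0) = dist p x0" by (rule isometry[OF g(1)])
    then have "dist z (\<phi> g x0) \<le> K"
      using dist_triangle[of z "\<phi> g x0" "\<phi> g p"] g(3) E[OF g(2)] K(4) by linarith
    then show "\<exists>g\<in>carrier G. dist z (\<phi> g x0) \<le> K" using g(1) by blast
  qed (rule K(1))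
qed

lemma cone_graph_quasi_isometric:
  "quasi_isometric (realisation cone_graph) (gdist cone_graph) (UNIV :: 'x set) dist"
proof -
  obtain x0 K where K: "1 \<le> K" and orbit_map: "\<forall>g\<in>carrier G. \<forall>h\<in>carrier G.
       real (cone_dist g h) / K - K \<le> dist (\<phi> g x0) (\<phi> h x0) \<and>
       dist (\<phi> g x0) (\<phi> h x0) \<le> K * real (cone_dist g h) + K"
    and dense: "\<forall>z. \<exists>g\<in>carrier G. dist z (\<phi> g x0) \<le> K"
    using orbit_map_quasi_isometry by blast
  define f where "f p = \<phi> (nearby_element p) x0" for p
  show ?thesis
    unfolding quasi_isometric_def
  proof (rule bexI[of _ f], rule exI[of _ K], rule conjI[OF K], rule exI[of _ "4 * K"], intro conjI ballI)
    fix p q assume pq: "p \<in> realisation cone_graph" "q \<in> realisation cone_graph"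
    define n where "n = real (cone_dist (nearby_element p) (nearby_element q))"
    have near: "\<bar>gdist cone_graph p q - n\<bar> \<le> 3" unfolding n_def by (rule gdist_near_cone_dist[OF pq])
    have carr: "nearby_element p \<in> carrier G" "nearby_element q \<in> carrier G"
      using pq nearby_element_carrier by blast+
    have "gdist cone_graph p q / K \<le> (n + 3) / K" using near K by (intro divide_right_mono) auto
    also have "\<dots> \<le> n / K + 3" using K by (simp add: field_simps)
    finally have "gdist cone_graph p q / K \<le> n / K + 3" .
    moreover have "n / K - K \<le> dist (f p) (f q)" "dist (f p) (f q) \<le> K * n + K"
      using orbit_map carr unfolding f_def n_def by blast+
    moreover have "K * n \<le> K * (gdist cone_graph p q + 3)" using near K by (intro mult_left_mono) auto
    ultimately show "gdist cone_graph p q / K - 4 * K \<le> dist (f p) (f q)"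
      "dist (f p) (f q) \<le> K * gdist cone_graph p q + 4 * K"
      using K by (simp_all add: algebra_simps)
  next
    fix z
    obtain g where g: "g \<in> carrier G" "dist z (\<phi> g x0) \<le> K" using dense by blast
    have "Vertex (Elem g) \<in> realisation cone_graph"
      unfolding realisation_def using Elem_vert[OF g(1)] by blast
    moreover have "dist z (f (Vertex (Elem g))) \<le> 4 * K" using g(2) K by (simp add: f_def)
    ultimately show "\<exists>p\<in>realisation cone_graph. dist z (f p) \<le> 4 * K" by blast
  qed (use K in auto)
qed

lemma cone_graph_hyperbolic:
  assumes "gromov_hyperbolic (UNIV :: 'x set) dist"
  shows "gromov_hyperbolic (realisation cone_graph) (gdist cone_graph)"
proof -
  obtain x0 K where K: "1 \<le> K" and orbit_map: "\<forall>g\<in>carrier G. \<forall>h\<in>carrier G.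
       real (cone_dist g h) / K - K \<le> dist (\<phi> g x0) (\<phi> h x0) \<and>
       dist (\<phi> g x0) (\<phi> h x0) \<le> K * real (cone_dist g h) + K"
    using orbit_map_quasi_isometry by blast
  have "gromov_hyperbolic (carrier G) (\<lambda>g h. real (cone_dist g h))"
    using orbit_map by (intro hyperbolic_if_quasi_isometric_embedding[OF length assms K, of "\<lambda>g. \<phi> g x0"]) auto
  then show ?thesis
    using nearby_element_carrier gdist_near_cone_dist
    by (intro gromov_hyperbolic_pullback[where h = nearby_element and C = 3]) auto
qed

end

section \<open>Finiteness of the representatives, and the quasi-isometry\<close>

theorem theorem5p1:
  fixes G :: "('g, 'm) monoid_scheme"
    and \<phi> :: "'g \<Rightarrow> 'x::metric_space \<Rightarrow> 'x"
    and \<H> :: "'g set set"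
  assumes "group G"
    and "finitely_generated G"
    and "length_space TYPE('x)"
    and "isometric_action G \<phi>"
    and "discontinuous_action G \<phi>"
    and "cocompact_action G \<phi>"
    and "maximal_isotropy_representatives G \<phi> \<H>"
  shows "finite \<H> \<and>
    (isotropy_subgroups_below_maximal G \<phi> \<longrightarrow>
      (\<forall>S. finite_generating_set G S \<longrightarrow>
         quasi_isometric
           (realisation (coned_off_cayley_graph G S \<H>)) (gdist (coned_off_cayley_graph G S \<H>))
           (UNIV :: 'x set) dist) \<and>
      (gromov_hyperbolic (UNIV :: 'x set) dist \<longrightarrow> weakly_hyperbolic_relative_to G \<H>))"
proof -
  have action: "discontinuous_isometric_action G \<phi>"
    using assms(4,5)
    by (simp add: discontinuous_isometric_action_def discontinuous_isometric_action_axioms_def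
        isometric_action_def discontinuous_action_def)
  have finite: "finite \<H>"
    using discontinuous_isometric_action.finite_maximal_isotropy_representatives[OF action] assms(6,7) .
  have subgroups: "subgroup H G" if "H \<in> \<H>" for H
    using assms(7) that
    unfolding maximal_isotropy_representatives_def maximal_isotropy_subgroup_def isotropy_subgroup_def by blast
  have coned: "coned_off_action G S \<H> \<phi>"
    if "isotropy_subgroups_below_maximal G \<phi>" "finite_generating_set G S" for S
    using that assms action subgroups
    by (auto simp: coned_off_action_def coned_off_action_axioms_def coned_off_def coned_off_axioms_def
        finite_generating_set_def)
  show ?thesis
    using finite subgroups assms(2) coned_off_action.cone_graph_quasi_isometric[OF coned]
      coned_off_action.cone_graph_hyperbolic[OF coned]
    unfolding weakly_hyperbolic_relative_to_def by blast
qed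

end
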